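(* Let $n\equiv 1\pmod 4$ be a positive integer. Then \[ \sum_{k=0}^{(n-1)/4}[8k+1]\frac{(q;q^4)_k^4}{(q^4;q^4)_k^4}q^{2k}\equiv \frac{(q^2;q^4)_{(n-1)/4}}{(q^4;q^4)_{(n-1)/4}}[n]\,q^{(1-n)/4}\pmod{[n]\Phi_n(q)^2}, \] and \[ \sum_{k=0}^{n-1}[8k+1]\frac{(q;q^4)_k^4}{(q^4;q^4)_k^4}q^{2k}\equiv \frac{(q^2;q^4)_{(n-1)/4}}{(q^4;q^4)_{(n-1)/4}}[n]\,q^{(1-n)/4}\pmod{[n]\Phi_n(q)^2}. \]
   Context: For an indeterminate $q$, $(a;q)_k=(1-a)(1-aq)\cdots(1-aq^{k-1})$ (with $(a;q)_0=1$) is the $q$-shifted factorial. For an integer $m$, $[m]=[m]_q=(1-q^m)/(1-q)$ is the $q$-integer. $\Phi_n(q)$ denotes the $n$-th cyclotomic polynomial in $q$. A congruence $A\equiv B\pmod{P(q)}$ between rational functions in $q$ means that $A-B$, written as a quotient of polynomials with denominator coprime to $P(q)$, has numerator divisible by $P(q)$. *)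

theory Defs
  imports "HOL-Computational_Algebra.Computational_Algebra"
begin

type_synonym ratfun = "rat poly fract"

definition qvar :: ratfun where "qvar = Fract [:0, 1:] 1"

definition qpoch :: "'a::comm_ring_1 \<Rightarrow> 'a \<Rightarrow> nat \<Rightarrow> 'a" where
  "qpoch a q k = (\<Prod>j<k. 1 - a * q ^ j)"

definition qint :: "'a::field \<Rightarrow> nat \<Rightarrow> 'a" where
  "qint q m = (1 - q ^ m) / (1 - q)"

definition qint_poly :: "nat \<Rightarrow> rat poly" where
  "qint_poly m = (\<Sum>i<m. monom 1 i)"

text \<open>Cyclotomic polynomials via q^n - 1 = prod over d | n of Phi_d\<close>
function cyclo :: "nat \<Rightarrow> rat poly" where
  "cyclo n = (monom 1 n - 1) div (\<Prod>d\<in>{d. d dvd n \<and> d < n}. cyclo d)"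
  by auto
termination by (relation "measure id") auto

definition qcong :: "ratfun \<Rightarrow> ratfun \<Rightarrow> rat poly \<Rightarrow> bool" where
  "qcong A B P \<longleftrightarrow> (\<exists>N D. D \<noteq> 0 \<and> coprime D P \<and> P dvd N \<and> A - B = Fract N D)"

end

theory Submission
  imports Defs "HOL-Computational_Algebra.Field_as_Ring"
begin

text \<open>
  Write \<open>n = 4N + 1\<close> and let \<open>t_k\<close> be the summand. Replacing two of the four numerator factors
  \<open>(q;q^4)_k\<close> by \<open>(aq;q^4)_k (q/a;q^4)_k\<close>, and correspondingly in the denominator, deforms the sum;
  at \<open>a = q^n\<close> it terminates and is evaluated exactly by the very-well-poised \<open>6\<phi>5\<close> summation, giving
  the right-hand side. The deformation depends on \<open>a\<close> only through \<open>x = 2 - a - 1/a\<close>, which for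
  \<open>a = q^n\<close> is divisible by \<open>\<Phi>_n^2\<close>, so modulo \<open>\<Phi>_n^3\<close> only the first-order term
  \<open>x * (\<Sum>k\<le>N. t_k * E_k)\<close> separates the two sums. Modulo \<open>\<Phi>_n\<close> the substitution
  \<open>k \<mapsto> N - k\<close> negates \<open>t_k\<close> and fixes \<open>E_k\<close>, which kills it. For a general divisor \<open>d > 1\<close> of
  \<open>n\<close>, the same antisymmetry inside each block of \<open>d\<close> consecutive indices shows that both sums vanish
  modulo \<open>\<Phi>_d\<close>.
\<close>

declare cyclo.simps [simp del]

section \<open>A terminating very-well-poised summation\<close>

lemma qpoch_0 [simp]: "qpoch a q 0 = 1"
  by (simp add: qpoch_def)

lemma qpoch_Suc: "qpoch a q (Suc k) = qpoch a q k * (1 - a * q ^ k)"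
  by (simp add: qpoch_def)

lemma qpoch_Suc_left: "qpoch a q (Suc k) = (1 - a) * qpoch (a * q) q k"
  unfolding qpoch_def by (subst prod.lessThan_Suc_shift) (simp add: mult.assoc)

lemma qpoch_nonzero:
  fixes a q :: "'a::field"
  shows "(\<And>j. j < k \<Longrightarrow> a * q ^ j \<noteq> 1) \<Longrightarrow> qpoch a q k \<noteq> 0"
  unfolding qpoch_def by (auto simp: prod_zero_iff)

text \<open>The \<open>k\<close>-th term of the \<open>6\<phi>5\<close> series in base \<open>p\<close> with parameters \<open>A, A, C, p^(-N)\<close>.\<close>
definition vwp :: "'a::field \<Rightarrow> 'a \<Rightarrow> 'a \<Rightarrow> nat \<Rightarrow> nat \<Rightarrow> 'a" where
  "vwp p A C N k = (1 - A * p ^ (2*k)) / (1 - A) *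
     (qpoch A p k ^ 2 * qpoch C p k * qpoch (inverse (p ^ N)) p k) /
     (qpoch p p k ^ 2 * qpoch (A * p / C) p k * qpoch (A * p ^ Suc N) p k) * (p ^ Suc N / C) ^ k"

text \<open>With \<open>X = p^k\<close> and \<open>Y = p^(N+1)\<close>, this is what is left of the
  Wilf-Zeilberger equation at index \<open>k\<close> once the factor common to its four terms and
  the denominator of \<open>wz_mul N\<close> are cleared.\<close>

lemma wz_identity:
  fixes A C X Y :: "'a::field"
  assumes "Y \<noteq> 0" "C \<noteq> 0"
  shows "(1 - A*Y) * (Y/C * ((1 - X/Y) * (1 - A*X)^2 * (1 - C*X)) - (1 - X)^2 * (1 - A*X/C) * (1 - A*X*Y))
    = (1 - A*X^2) * ((1 - 1/Y) * (1 - A*Y) * X * ((1 - Y) * (1 - A*Y/C))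
        - (1 - A*Y) * (1 - Y/C) * (1 - X/Y) * (1 - A*X*Y))"
  using assms by (simp add: field_simps) algebra

context
  fixes p A C :: "'a::field"
  assumes p_root: "\<And>j. j > 0 \<Longrightarrow> p ^ j \<noteq> 1" and p0: "p \<noteq> 0" and C0: "C \<noteq> 0"
    and A_pow: "\<And>j. A * p ^ j \<noteq> 1" and AC: "\<And>j. j > 0 \<Longrightarrow> A * p ^ j \<noteq> C"
begin

text \<open>Times \<open>1 - p^(N+1)/C\<close>, this is the ratio of consecutive closed forms in
  \<open>vwp_sum\<close>.\<close>

definition wz_mul :: "nat \<Rightarrow> 'a" where
  "wz_mul N = (1 - A * p ^ Suc N) / ((1 - p ^ Suc N) * (1 - A * p ^ Suc N / C))"

text \<open>The companion in a Wilf-Zeilberger pair; it proves the recurrence in \<open>N\<close> satisfied by the sum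
  over \<open>k\<close> of \<open>vwp p A C N k\<close>. The index \<open>k - 1\<close> is truncated at \<open>k = 0\<close>; only \<open>k > 0\<close> is used.\<close>
definition wz_cert :: "nat \<Rightarrow> nat \<Rightarrow> 'a" where
  "wz_cert N k = wz_mul N * (1 - p ^ k)^2 * (1 - A * p ^ k / C) / (1 - A) *
     (qpoch A p k ^ 2 * qpoch C p k * qpoch (inverse (p ^ N)) p (k - 1)) /
     (qpoch p p k ^ 2 * qpoch (A * p / C) p k * qpoch (A * p ^ Suc N) p k) * (p ^ Suc N / C) ^ k"

lemma denominators_nonzero:
  "qpoch p p k \<noteq> 0" "qpoch (A * p / C) p k \<noteq> 0" "qpoch (A * p ^ N) p k \<noteq> 0"
proof -
  show "qpoch p p k \<noteq> 0"
    using p_root[of "Suc _"] by (intro qpoch_nonzero) auto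
  have "A * p / C * p ^ j \<noteq> 1" for j
    using AC[of "Suc j"] C0 by (auto simp: field_simps)
  then show "qpoch (A * p / C) p k \<noteq> 0"
    by (rule qpoch_nonzero)
  have "A * p ^ N * p ^ j \<noteq> 1" for j
    using A_pow[of "N + j"] by (simp add: power_add mult.assoc)
  then show "qpoch (A * p ^ N) p k \<noteq> 0"
    by (rule qpoch_nonzero)
qed

lemma vwp_diff:
  "vwp p A C (Suc N) (Suc k) - wz_mul N * (1 - p ^ Suc N / C) * vwp p A C N (Suc k) =
   wz_cert N (Suc (Suc k)) - wz_cert N (Suc k)"
proof -
  define Y where "Y = p ^ Suc N"
  define X where "X = p ^ Suc k"
  define D where "D = (1 - Y) * (1 - A * Y / C)"
  have Y0: "Y \<noteq> 0" and X0: "X \<noteq> 0" using p0 by (auto simp: Y_def X_def)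
  have "1 - Y \<noteq> 0" "1 - A * Y / C \<noteq> 0"
    using AC[of "Suc N"] p_root[of "Suc N"] C0 by (auto simp: Y_def divide_simps)
  then have D0: "D \<noteq> 0"
    by (simp add: D_def)
  have A1: "1 - A \<noteq> 0" using A_pow[of 0] by auto
  have AY: "1 - A * Y \<noteq> 0" using A_pow[of "Suc N"] by (auto simp: Y_def)
  have AXY: "1 - A * X * Y \<noteq> 0"
    using A_pow[of "Suc N + Suc k"] by (auto simp: Y_def X_def power_add mult_ac)
  have pX: "1 - p * X \<noteq> 0" using p_root[of "Suc (Suc k)"] by (auto simp: X_def)
  have ApX: "A * (p * X) \<noteq> C"
    using AC[of "Suc (Suc k)"] by (simp add: X_def)
  define a1 where "a1 = qpoch A p (Suc k)"
  define c1 where "c1 = qpoch C p (Suc k)"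
  define p1 where "p1 = qpoch p p (Suc k)"
  define ac1 where "ac1 = qpoch (A * p / C) p (Suc k)"
  define ay1 where "ay1 = qpoch (A * Y) p (Suc k)"
  define d0 where "d0 = qpoch (p / Y) p k"
  define zk where "zk = (Y / C) ^ Suc k"
  have nz: "p1 \<noteq> 0" "ac1 \<noteq> 0" "ay1 \<noteq> 0"
    using denominators_nonzero(1,2)[of "Suc k"] denominators_nonzero(3)[of "Suc N" "Suc k"] by (auto simp: p1_def ac1_def ay1_def Y_def simp del: power_Suc)
  have inv: "inverse (p ^ N) = p / Y" "inverse (p ^ Suc N) = 1 / Y"
    using p0 by (auto simp: Y_def field_simps)
  have AYp: "qpoch (A * p ^ Suc (Suc N)) p (Suc k) = ay1 * (1 - A * X * Y) / (1 - A * Y)"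
  proof -
    have "(1 - A * Y) * qpoch (A * Y * p) p (Suc k) = ay1 * (1 - A * Y * p ^ Suc k)"
      unfolding ay1_def qpoch_Suc_left[symmetric] by (rule qpoch_Suc)
    moreover have "A * Y * p = A * p ^ Suc (Suc N)" "A * Y * p ^ Suc k = A * X * Y"
      by (simp_all add: X_def Y_def mult_ac)
    ultimately show ?thesis
      using AY by (metis nonzero_mult_div_cancel_left)
  qed
  have dS: "qpoch (p / Y) p (Suc k) = d0 * (1 - X / Y)"
    by (simp add: qpoch_Suc d0_def X_def)
  have dY: "qpoch (1 / Y) p (Suc k) = (1 - 1 / Y) * d0"
    by (simp add: qpoch_Suc_left d0_def)
  \<comment> \<open>\<open>W\<close> is the factor shared by all four terms: \<open>f0\<close>,
    \<open>f1\<close>, \<open>h0\<close> and \<open>h1\<close> write each of them as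
    \<open>W\<close> times a few linear factors, up to \<open>wz_mul N\<close>, which reduces the
    claim to \<open>wz_identity\<close>.\<close>
  define W where "W = a1^2 * c1 * d0 * zk / (p1^2 * ac1 * ay1 * (1 - A * X * Y) * (1 - A))"
  have X2: "p ^ (2 * Suc k) = X^2" unfolding X_def power_mult[symmetric] by (simp only: mult.commute)
  have zk': "(p ^ Suc (Suc N) / C) ^ Suc k = zk * X"
    by (simp add: zk_def X_def Y_def power_divide power_mult_distrib mult_ac)
  have f0: "vwp p A C N (Suc k) = (1 - A*X^2) * W * (1 - A*X*Y) * (1 - X/Y)"
    unfolding vwp_def inv X2 dS W_def
    using AXY A1 nz unfolding Y_def[symmetric] a1_def[symmetric] c1_def[symmetric] p1_def[symmetric]
      ac1_def[symmetric] ay1_def[symmetric] zk_def[symmetric] dS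
    by (simp add: divide_simps)
  have f1: "vwp p A C (Suc N) (Suc k) = (1 - A*X^2) * W * (1 - A*Y) * (1 - 1/Y) * X"
    unfolding vwp_def inv X2 dY W_def AYp zk'
      a1_def[symmetric] c1_def[symmetric] p1_def[symmetric] ac1_def[symmetric]
    using AXY A1 AY nz by (simp add: divide_simps)
  have mu: "wz_mul N = (1 - A * Y) / D" by (simp add: wz_mul_def Y_def D_def)
  have h0: "wz_cert N (Suc k) = wz_mul N * W * (1 - A*X*Y) * (1 - X)^2 * (1 - A*X/C)"
    unfolding wz_cert_def inv X_def[symmetric] Y_def[symmetric] W_def diff_Suc_1
      a1_def[symmetric] c1_def[symmetric] p1_def[symmetric] ac1_def[symmetric] ay1_def[symmetric]
      zk_def[symmetric] d0_def[symmetric]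
    using AXY A1 AY nz by (simp add: divide_simps)
  have h1a: "qpoch A p (Suc (Suc k)) = a1 * (1 - A*X)" "qpoch C p (Suc (Suc k)) = c1 * (1 - C*X)"
    "qpoch p p (Suc (Suc k)) = p1 * (1 - p*X)"
    "qpoch (A * p / C) p (Suc (Suc k)) = ac1 * (1 - A*p*X/C)"
    "qpoch (A * Y) p (Suc (Suc k)) = ay1 * (1 - A*X*Y)"
    "(Y / C) ^ Suc (Suc k) = zk * (Y/C)" "p ^ Suc (Suc k) = p * X"
    by (simp_all add: qpoch_Suc[of _ _ "Suc k"] a1_def c1_def p1_def ac1_def ay1_def X_def zk_def mult_ac)
  have h1: "wz_cert N (Suc (Suc k)) = wz_mul N * (Y/C) * W * (1 - A*X)^2 * (1 - C*X) * (1 - X/Y)"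
    unfolding wz_cert_def inv Y_def[symmetric] W_def diff_Suc_1 h1a dS
    using AXY A1 AY nz pX ApX C0 by (simp add: divide_simps mult.assoc)
  have muD: "wz_mul N * D = 1 - A * Y" using D0 by (simp add: mu)
  have "(vwp p A C (Suc N) (Suc k) - wz_mul N * (1 - Y / C) * vwp p A C N (Suc k)) * D =
     vwp p A C (Suc N) (Suc k) * D - (wz_mul N * D) * (1 - Y / C) * vwp p A C N (Suc k)"
    by algebra
  also have "\<dots> = W * ((1 - A * X^2) * ((1 - 1/Y) * (1 - A*Y) * X * D
        - (1 - A*Y) * (1 - Y/C) * (1 - X/Y) * (1 - A*X*Y)))"
    unfolding f0 f1 muD
    by algebra
  also have "\<dots> = W * ((1 - A*Y) * (Y/C * ((1 - X/Y) * (1 - A*X)^2 * (1 - C*X))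
       - (1 - X)^2 * (1 - A*X/C) * (1 - A*X*Y)))"
    unfolding D_def by (subst wz_identity[OF Y0 C0]) simp
  also have "\<dots> = W * ((wz_mul N * D) * (Y/C * ((1 - X/Y) * (1 - A*X)^2 * (1 - C*X))
       - (1 - X)^2 * (1 - A*X/C) * (1 - A*X*Y)))"
    unfolding muD ..
  also have "\<dots> = (wz_cert N (Suc (Suc k)) - wz_cert N (Suc k)) * D"
    unfolding h0 h1
    by algebra
  finally show ?thesis using D0 unfolding Y_def by simp
qed

text \<open>The start of the telescoping. The factor \<open>(1 - p ^ k)^2\<close> makes the
  certificate vanish at \<open>k = 0\<close>, so there is no lower boundary term.\<close>

lemma vwp_diff_0:
  "vwp p A C (Suc N) 0 - wz_mul N * (1 - p ^ Suc N / C) * vwp p A C N 0 = wz_cert N (Suc 0)"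
proof -
  define Y where "Y = p ^ Suc N"
  have 1: "Y \<noteq> 1" "A * Y \<noteq> 1" "A * Y \<noteq> C" "A \<noteq> 1" "p \<noteq> 1" "A * p \<noteq> C"
    using A_pow[of "Suc N"] A_pow[of 0] AC[of "Suc N"] AC[of 1] p_root[of "Suc N"] p_root[of 1] by (auto simp: Y_def)
  show ?thesis
    unfolding vwp_def wz_cert_def wz_mul_def Y_def[symmetric] using 1 C0
    by (simp add: qpoch_def divide_simps) algebra
qed

lemma sum_vwp_diff:
  "(\<Sum>k\<le>K. vwp p A C (Suc N) k - wz_mul N * (1 - p ^ Suc N / C) * vwp p A C N k) = wz_cert N (Suc K)"
proof (induction K)
  case 0
  then show ?case by (simp only: vwp_diff_0 sum.atMost_Suc atMost_0) (simp add: vwp_diff_0 del: power_Suc)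
next
  case (Suc K)
  then show ?case by (simp only: sum.atMost_Suc vwp_diff) simp
qed

lemma qpoch_inverse_eq_0:
  assumes "N < k" shows "qpoch (inverse (p ^ N)) p k = 0"
  unfolding qpoch_def using assms p0 by (auto simp: prod_zero_iff intro!: bexI[of _ N])

theorem vwp_sum:
  "(\<Sum>k\<le>N. vwp p A C N k) =
     qpoch (A * p) p N * qpoch (p / C) p N / (qpoch p p N * qpoch (A * p / C) p N)"
proof (induction N)
  case 0
  show ?case using A_pow[of 0] by (simp add: vwp_def)
next
  case (Suc N)
  \<comment> \<open>The sum for \<open>N\<close> may be extended to \<open>N + 1\<close>, so that
    both sums have the same range.\<close>
  have last: "vwp p A C N (Suc N) = 0"
    by (simp add: vwp_def qpoch_inverse_eq_0)
  \<comment> \<open>The upper boundary term contains the factor \<open>1 - p^(-N) p^N = 0\<close>,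
    so the telescoped identity becomes a first-order recurrence in \<open>N\<close>.\<close>
  have "wz_cert N (Suc (Suc N)) = 0"
    by (simp add: wz_cert_def qpoch_inverse_eq_0 del: power_Suc)
  then have "(\<Sum>k\<le>Suc N. vwp p A C (Suc N) k) =
      wz_mul N * (1 - p ^ Suc N / C) * (\<Sum>k\<le>Suc N. vwp p A C N k)"
    using sum_vwp_diff[of N "Suc N"]
    by (simp only: sum_subtractf sum_distrib_left[symmetric]) simp
  also have "(\<Sum>k\<le>Suc N. vwp p A C N k) = (\<Sum>k\<le>N. vwp p A C N k)"
    by (simp add: last)
  also note Suc.IH
  finally show ?case
    unfolding qpoch_Suc wz_mul_def by (simp add: mult_ac)
qed

end

section \<open>Congruences in a local ring of rational functions\<close>

lemma one_minus_power_mult: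
  fixes x :: "'a::field"
  shows "1 - x ^ (d * m) = (1 - x ^ d) * (\<Sum>i<m. (x ^ d) ^ i)"
  by (simp only: power_mult one_diff_power_eq)

lemma sum_lessThan_block:
  fixes f :: "nat \<Rightarrow> 'a::comm_monoid_add"
  shows "(\<Sum>k<a + b. f k) = (\<Sum>k<a. f k) + (\<Sum>r<b. f (a + r))"
  by (induction b) (simp_all add: add.assoc)

lemma shifted_factor_identity:
  fixes a m :: "'a::field"
  assumes "1 - m \<noteq> 0" "a \<noteq> 0"
  shows "1 + - ((1 - a) ^ 2) * inverse a * (m * inverse (1 - m) ^ 2) = (1 - a * m) * (1 - m / a) / (1 - m) ^ 2"
  using assms by (simp add: divide_simps) algebra

lemma reflected_difference_identity:
  fixes y y' :: "'a::field"
  assumes "1 - y \<noteq> 0" "1 - y' \<noteq> 0"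
  shows "y' * inverse (1 - y') ^ 2 - y * inverse (1 - y) ^ 2 =
      (1 - y * y') * ((y' - y) * inverse (1 - y) ^ 2 * inverse (1 - y') ^ 2)"
  using assms by (simp add: divide_simps) algebra

text \<open>
  The model is the localization \<open>V\<close> of \<open>\<rat>[q]\<close> at \<open>\<pi> = \<Phi>_d\<close>. The last assumption expresses
  that \<open>1 - q^(dm)\<close> is squarefree, so that \<open>\<Phi>_d\<close> divides it exactly once.
\<close>
locale q_local_ring =
  fixes V :: "'a::field set" and \<pi> q :: 'a and d N :: nat
  assumes V_1: "1 \<in> V"
    and V_diff: "x \<in> V \<Longrightarrow> y \<in> V \<Longrightarrow> x - y \<in> V"
    and V_mult: "x \<in> V \<Longrightarrow> y \<in> V \<Longrightarrow> x * y \<in> V"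
    and V_pi: "\<pi> \<in> V"
    and V_half: "inverse 2 \<in> V" and two: "(2::'a) \<noteq> 0"
    and V_q: "q \<in> V" and V_inverse_q: "inverse q \<in> V" and q0: "q \<noteq> 0"
    and q_root: "m > 0 \<Longrightarrow> q ^ m \<noteq> 1"
    and d_gt_1: "d > 1" and d_dvd: "d dvd 4 * N + 1"
    and pi_dvd: "\<exists>z\<in>V. 1 - q ^ d = \<pi> * z"
    and V_unit: "\<not> d dvd m \<Longrightarrow> inverse (1 - q ^ m) \<in> V"
    and V_quot: "m > 0 \<Longrightarrow> (1 - q ^ d) / (1 - q ^ (d * m)) \<in> V"
begin

section \<open>Ring closure and congruence modulo \<open>\<pi>\<close>\<close>

lemma V_0: "0 \<in> V"
  using V_diff[OF V_1 V_1] by simp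

lemma V_uminus: "x \<in> V \<Longrightarrow> - x \<in> V"
  using V_diff[OF V_0] by fastforce

lemma V_add: "x \<in> V \<Longrightarrow> y \<in> V \<Longrightarrow> x + y \<in> V"
  using V_diff[OF _ V_uminus] by fastforce

lemma V_power: "x \<in> V \<Longrightarrow> x ^ k \<in> V"
  by (induction k) (auto intro: V_1 V_mult)

lemma V_prod: "(\<And>i. i \<in> I \<Longrightarrow> f i \<in> V) \<Longrightarrow> prod f I \<in> V"
  by (induction I rule: infinite_finite_induct) (auto intro: V_1 V_mult)

lemma V_sum: "(\<And>i. i \<in> I \<Longrightarrow> f i \<in> V) \<Longrightarrow> sum f I \<in> V"
  by (induction I rule: infinite_finite_induct) (auto intro: V_0 V_add)

text \<open>Congruence modulo the ideal \<open>\<pi> V\<close>, but on the whole field: membership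
  in \<open>V\<close> is demanded only where products or inverses require it.\<close>

definition cg :: "'a \<Rightarrow> 'a \<Rightarrow> bool" (infix "\<simeq>" 50) where
  "x \<simeq> y \<longleftrightarrow> (\<exists>z\<in>V. x - y = \<pi> * z)"

lemma cgI: "z \<in> V \<Longrightarrow> x - y = \<pi> * z \<Longrightarrow> x \<simeq> y"
  by (auto simp: cg_def)

lemma cg_refl [simp]: "x \<simeq> x"
  by (rule cgI[OF V_0]) simp

lemma cg_0_iff: "x \<simeq> y \<longleftrightarrow> x - y \<simeq> 0"
  by (simp add: cg_def)

lemma cg_add: "x \<simeq> x' \<Longrightarrow> y \<simeq> y' \<Longrightarrow> x + y \<simeq> x' + y'"
  unfolding cg_def by (metis V_add add_diff_add distrib_left)

lemma cg_sym: "x \<simeq> y \<Longrightarrow> y \<simeq> x"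
  unfolding cg_def by (metis V_uminus minus_diff_eq mult_minus_right)

lemma cg_trans [trans]: "x \<simeq> y \<Longrightarrow> y \<simeq> z \<Longrightarrow> x \<simeq> z"
  using cg_add[of "x - y" 0 "y - z" 0] by (simp add: cg_0_iff[of x y] cg_0_iff[of y z] cg_0_iff[of x z])

lemma cg_mult_0: "x \<simeq> 0 \<Longrightarrow> y \<in> V \<Longrightarrow> x * y \<simeq> 0"
  unfolding cg_def by (metis V_mult diff_zero mult.assoc)

lemma cg_mult:
  assumes "x \<simeq> x'" "y \<simeq> y'" "x' \<in> V" "y \<in> V" shows "x * y \<simeq> x' * y'"
proof -
  have "(x - x') * y + (y - y') * x' \<simeq> 0 + 0"
    using assms by (intro cg_add cg_mult_0) (auto simp: cg_0_iff[symmetric])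
  then show ?thesis
    by (subst cg_0_iff) (simp add: algebra_simps)
qed

lemma cg_mult_left: "x \<simeq> y \<Longrightarrow> c \<in> V \<Longrightarrow> c * x \<simeq> c * y"
  using cg_mult_0[of "x - y" c] cg_0_iff[of x y] cg_0_iff[of "c * x" "c * y"] by (simp add: algebra_simps)

lemma cg_minus: "x \<simeq> y \<Longrightarrow> - x \<simeq> - y"
  using cg_mult_left[of x y "-1"] V_uminus[OF V_1] by simp

lemma cg_diff: "x \<simeq> x' \<Longrightarrow> y \<simeq> y' \<Longrightarrow> x - y \<simeq> x' - y'"
  using cg_add[of x x' "-y" "-y'"] cg_minus by simp

lemma cg_V: "x \<simeq> y \<Longrightarrow> y \<in> V \<Longrightarrow> x \<in> V"
  unfolding cg_def by (metis V_add V_mult V_pi diff_add_cancel)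

lemma cg_power: "x \<simeq> y \<Longrightarrow> y \<in> V \<Longrightarrow> x ^ k \<simeq> y ^ k"
  by (induction k) (auto intro!: cg_mult V_power intro: cg_V)

lemma cg_prod:
  "(\<And>i. i \<in> I \<Longrightarrow> f i \<simeq> g i) \<Longrightarrow> (\<And>i. i \<in> I \<Longrightarrow> g i \<in> V) \<Longrightarrow> prod f I \<simeq> prod g I"
  by (induction I rule: infinite_finite_induct) (auto intro!: cg_mult V_prod intro: cg_V)

lemma cg_sum: "(\<And>i. i \<in> I \<Longrightarrow> f i \<simeq> g i) \<Longrightarrow> sum f I \<simeq> sum g I"
  by (induction I rule: infinite_finite_induct) (auto intro!: cg_add)

lemma cg_cancel:
  assumes "c * x \<simeq> c * y" "inverse c \<in> V" "c \<noteq> 0" shows "x \<simeq> y"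
  using cg_mult_left[OF assms(1,2)] assms(3) by (simp add: mult.assoc[symmetric])

lemma cg_inverse:
  assumes "x \<simeq> y" "inverse x \<in> V" "inverse y \<in> V" "x \<noteq> 0" "y \<noteq> 0"
  shows "inverse x \<simeq> inverse y"
proof -
  have "(y - x) * (inverse x * inverse y) \<simeq> 0"
    using assms cg_sym[OF assms(1)] by (intro cg_mult_0 V_mult) (auto simp: cg_0_iff[symmetric])
  then show ?thesis
    using assms(4,5) by (subst cg_0_iff) (simp add: field_simps)
qed

section \<open>Powers of \<open>q\<close> modulo \<open>\<pi>\<close>\<close>

lemma q_pow_neq_1: "m > 0 \<Longrightarrow> 1 - q ^ m \<noteq> 0"
  using q_root by force

lemma V_1_q: "1 - q ^ m \<in> V"
  by (intro V_diff V_1 V_power V_q)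

lemma V_inverse_q_power: "inverse (q ^ m) \<in> V"
  using V_power[OF V_inverse_q, of m] by (simp add: power_inverse)

lemma one_minus_q_cg_0: "d dvd m \<Longrightarrow> 1 - q ^ m \<simeq> 0"
proof (erule dvdE)
  fix k assume m: "m = d * k"
  have "1 - q ^ d \<simeq> 0"
    using pi_dvd by (auto simp: cg_def)
  then show ?thesis
    unfolding m one_minus_power_mult by (intro cg_mult_0 V_sum V_power V_q)
qed

lemma q_cg_1: "d dvd m \<Longrightarrow> q ^ m \<simeq> 1"
  using one_minus_q_cg_0[of m] cg_sym[of 1 "q^m"] by (simp add: cg_0_iff[of 1])

lemma q_cg_add: "d dvd m \<Longrightarrow> q ^ (m + k) \<simeq> q ^ k"
  using cg_mult[OF q_cg_1 cg_refl[of "q^k"] V_1] V_power[OF V_q] by (simp add: power_add)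

lemma d_coprime_4: "coprime d (4::nat)"
proof (rule coprimeI)
  fix c assume c: "c dvd d" "c dvd (4::nat)"
  have "c dvd 4 * N + 1" "c dvd 4 * N"
    using c d_dvd dvd_trans by (auto intro: dvd_mult2)
  then show "is_unit c"
    using dvd_diff_nat[of c "4 * N + 1" "4 * N"] by simp
qed

lemma d_dvd_4_mult: "d dvd 4 * m \<longleftrightarrow> d dvd m"
  using d_coprime_4 by (simp add: coprime_dvd_mult_right_iff)

section \<open>Integrality and vanishing of the quotients of \<open>q\<close>-shifted
  factorials\<close>

definition qratio :: "nat \<Rightarrow> nat \<Rightarrow> 'a" where
  "qratio s k = qpoch (q ^ s) (q ^ 4) k / qpoch (q ^ 4) (q ^ 4) k"

definition qfactor :: "nat \<Rightarrow> nat \<Rightarrow> 'a" where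
  "qfactor s k = (1 - q ^ (4 * k + s)) * inverse (1 - q ^ (4 * k + 4))"

lemma qratio_eq_prod: "qratio s k = (\<Prod>j<k. qfactor s j)"
  unfolding qratio_def qpoch_def prod_dividef[symmetric]
  by (intro prod.cong refl) (simp only: qfactor_def divide_inverse power_mult[symmetric] power_add[symmetric] add.commute)

lemma qratio_add: "qratio s (k + r) = qratio s k * (\<Prod>j<r. qfactor s (k + j))"
  unfolding qratio_eq_prod by (induction r) (simp_all add: mult_ac)

text \<open>Modulo \<open>d\<close> the exponent is \<open>4(j+1)\<close>, with 4 invertible. The
  only index of a block whose denominator is not a unit is \<open>j = d - 1\<close>, which
  \<open>Suc j < d\<close> excludes.\<close>

lemma den_unit:
  assumes "Suc j < d" shows "inverse (1 - q ^ (4 * (d * t + j) + 4)) \<in> V"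
proof (rule V_unit)
  have "4 * (d * t + j) + 4 = d * (4 * t) + 4 * Suc j" by simp
  moreover have "\<not> d dvd 4 * Suc j"
    unfolding d_dvd_4_mult using assms by (auto dest: dvd_imp_le)
  ultimately show "\<not> d dvd 4 * (d * t + j) + 4"
    by (metis dvd_add_right_iff dvd_triv_left)
qed

lemma qfactor_V: "Suc j < d \<Longrightarrow> qfactor s (d * t + j) \<in> V"
  unfolding qfactor_def by (intro V_mult V_1_q den_unit)

text \<open>The solution of \<open>4r + s \<equiv> 0 (mod d)\<close> with \<open>0 \<le> r < d\<close>: the only index below \<open>d\<close> at which
  \<open>\<pi>\<close> divides the numerator of \<open>qfactor s\<close>.\<close>
definition rho :: "nat \<Rightarrow> nat" where "rho s = (s * N) mod d"

lemma rho_less: "rho s < d"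
  using d_gt_1 by (simp add: rho_def)

lemma rho_1:
  assumes "d = 4 * N + 1" shows "rho 1 = N"
proof -
  have "(1 * N) mod d = N" using assms by simp
  then show ?thesis by (simp only: rho_def)
qed

lemma rho_dvd: "d dvd 4 * rho s + s"
proof -
  have "d dvd s * (4 * N + 1)" using d_dvd by (rule dvd_mult)
  also have "s * (4 * N + 1) = 4 * (d * (s * N div d) + rho s) + s"
    by (simp add: rho_def algebra_simps)
  also have "\<dots> = d * (4 * (s * N div d)) + (4 * rho s + s)"
    by (simp add: algebra_simps)
  finally show ?thesis
    by (metis dvd_add_right_iff dvd_triv_left)
qed

text \<open>A full block contains the bad denominator at \<open>j = d - 1\<close>, but also the
  numerator at \<open>j = rho s\<close>, which is divisible by \<open>1 - q^d\<close>. Their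
  quotient lies in \<open>V\<close> by \<open>V_quot\<close>; every other factor lies in
  \<open>V\<close> by itself.\<close>

lemma block_V: "(\<Prod>j<d. qfactor s (d * t + j)) \<in> V"
proof -
  obtain m where m: "4 * rho s + s = d * m" using rho_dvd by blast
  define num where "num j = 1 - q ^ (4 * (d * t + j) + s)" for j
  define den where "den j = inverse (1 - q ^ (4 * (d * t + j) + 4))" for j
  have num: "prod num {..<d} = num (rho s) * prod num ({..<d} - {rho s})"
    using rho_less[of s] by (subst prod.remove[of _ "rho s"]) auto
  have den: "prod den {..<d} = den (d - 1) * prod den ({..<d} - {d - 1})"
    using d_gt_1 by (subst prod.remove[of _ "d - 1"]) auto
  have "4 * (d * t + rho s) + s = d * (4 * t + m)"
    using m by (simp add: algebra_simps)
  then have 1: "num (rho s) = (1 - q ^ d) * (\<Sum>i<4 * t + m. (q ^ d) ^ i)"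
    unfolding num_def by (simp only: one_minus_power_mult)
  have "4 * (d * t + (d - 1)) + 4 = d * (4 * Suc t)"
    using d_gt_1 by (cases d) (auto simp: algebra_simps)
  then have 2: "den (d - 1) = inverse (1 - q ^ (d * (4 * Suc t)))"
    unfolding den_def by simp
  have "num (rho s) * den (d - 1) =
      (\<Sum>i<4 * t + m. (q ^ d) ^ i) * ((1 - q ^ d) / (1 - q ^ (d * (4 * Suc t))))"
    unfolding 1 2 by (simp add: divide_inverse)
  then have "num (rho s) * den (d - 1) \<in> V"
    by (simp only:) (intro V_mult V_sum V_power V_q V_quot; simp)
  moreover have "prod num ({..<d} - {rho s}) \<in> V"
    unfolding num_def by (intro V_prod V_1_q)
  moreover have "prod den ({..<d} - {d - 1}) \<in> V"
    unfolding den_def by (intro V_prod den_unit) auto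
  moreover have "(\<Prod>j<d. qfactor s (d * t + j)) = (num (rho s) * den (d - 1)) *
      (prod num ({..<d} - {rho s}) * prod den ({..<d} - {d - 1}))"
    unfolding qfactor_def num_def[symmetric] den_def[symmetric] prod.distrib num den by (simp only: mult_ac)
  ultimately show ?thesis
    by (simp only: V_mult)
qed

lemma qratio_block_V: "qratio s (d * t) \<in> V"
proof (induction t)
  case 0
  then show ?case by (simp add: qratio_eq_prod V_1)
next
  case (Suc t)
  have "qratio s (d * Suc t) = qratio s (d * t) * (\<Prod>j<d. qfactor s (d * t + j))"
    using qratio_add[of s "d * t" d] by (simp add: add.commute)
  then show ?case using Suc block_V V_mult by simp
qed

lemma qratio_V: "qratio s k \<in> V"
proof -
  have "k mod d < d" using d_gt_1 by simp
  then have "qratio s (d * (k div d) + k mod d) \<in> V"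
    unfolding qratio_add by (intro V_mult qratio_block_V V_prod qfactor_V) simp
  then show ?thesis by simp
qed

lemma qfactor_rho:
  assumes "Suc (rho s) < d" shows "qfactor s (d * t + rho s) \<simeq> 0"
  unfolding qfactor_def
proof (intro cg_mult_0 one_minus_q_cg_0 den_unit assms)
  have "4 * (d * t + rho s) + s = d * (4 * t) + (4 * rho s + s)" by simp
  then show "d dvd 4 * (d * t + rho s) + s"
    using rho_dvd by (metis dvd_add dvd_triv_left)
qed

text \<open>The partial block already includes the vanishing numerator at \<open>rho s\<close> and
  stops before the denominator at \<open>d - 1\<close> that could compensate for it.\<close>

lemma qratio_cg_0:
  assumes "rho s < r" "r < d" shows "qratio s (d * t + r) \<simeq> 0"
proof -
  have "qfactor s (d * t + rho s) * (\<Prod>j\<in>{..<r} - {rho s}. qfactor s (d * t + j)) \<simeq> 0"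
    using assms by (intro cg_mult_0 qfactor_rho V_prod qfactor_V) auto
  then have "(\<Prod>j<r. qfactor s (d * t + j)) \<simeq> 0"
    using assms by (subst prod.remove[of _ "rho s"]) auto
  then show ?thesis
    unfolding qratio_add by (metis cg_mult_0 mult.commute qratio_block_V)
qed

lemma qfactor_shift:
  assumes "Suc j < d" shows "qfactor s (d * t + j) \<simeq> qfactor s j"
  unfolding qfactor_def
proof (intro cg_mult cg_inverse cg_diff cg_refl q_pow_neq_1 V_1_q den_unit assms)
  have "4 * (d * t + j) + i = d * (4 * t) + (4 * j + i)" for i by simp
  then have *: "q ^ (4 * (d * t + j) + i) \<simeq> q ^ (4 * j + i)" for i
    by (metis dvd_triv_left q_cg_add)
  show "q ^ (4 * (d * t + j) + s) \<simeq> q ^ (4 * j + s)" "q ^ (4 * (d * t + j) + 4) \<simeq> q ^ (4 * j + 4)"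
    by (rule *)+
  show "inverse (1 - q ^ (4 * j + 4)) \<in> V"
    using den_unit[OF assms, of 0] by simp
qed auto

text \<open>An analogue of Lucas' theorem: modulo \<open>\<pi>\<close>, a factor depends only on its
  position inside its block.\<close>

lemma qratio_shift:
  assumes "r < d" shows "qratio s (d * t + r) \<simeq> qratio s (d * t) * qratio s r"
proof -
  have "(\<Prod>j<r. qfactor s (d * t + j)) \<simeq> (\<Prod>j<r. qfactor s j)"
    using assms qfactor_V[of _ s 0] by (intro cg_prod qfactor_shift) auto
  then show ?thesis
    unfolding qratio_add by (metis cg_mult_left qratio_block_V qratio_eq_prod)
qed

section \<open>Block structure and antisymmetry of the summand\<close>

definition summand :: "nat \<Rightarrow> 'a" where
  "summand k = (1 - q ^ (8 * k + 1)) * inverse (1 - q) * qratio 1 k ^ 4 * q ^ (2 * k)"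

lemma inverse_1_q: "inverse (1 - q) \<in> V"
  using V_unit[of 1] d_gt_1 by simp

lemmas V_intros = V_1 V_mult V_power V_q V_1_q inverse_1_q qratio_V

lemma summand_V: "summand k \<in> V"
  unfolding summand_def by (intro V_intros)

lemma summand_shift:
  assumes "r < d" shows "summand (d * t + r) \<simeq> qratio 1 (d * t) ^ 4 * summand r"
proof -
  have e: "8 * (d * t + r) + 1 = d * (8 * t) + (8 * r + 1)" "2 * (d * t + r) = d * (2 * t) + 2 * r"
    by simp_all
  have "summand (d * t + r) \<simeq> (1 - q ^ (8 * r + 1)) * inverse (1 - q) * (qratio 1 (d * t) * qratio 1 r) ^ 4 * q ^ (2 * r)"
    unfolding summand_def e
    by (intro cg_mult cg_power cg_diff cg_refl q_cg_add qratio_shift V_intros assms) auto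
  also have "\<dots> = qratio 1 (d * t) ^ 4 * summand r"
    by (simp add: summand_def power_mult_distrib)
  finally show ?thesis .
qed

lemma summand_cg_0:
  assumes "rho 1 < r" "r < d" shows "summand (d * t + r) \<simeq> 0"
proof -
  have "qratio 1 (d * t + r) ^ 4 \<simeq> 0 ^ 4"
    using assms by (intro cg_power qratio_cg_0 V_0)
  then have "qratio 1 (d * t + r) ^ 4 *
      ((1 - q ^ (8 * (d * t + r) + 1)) * inverse (1 - q) * q ^ (2 * (d * t + r))) \<simeq> 0"
    by (intro cg_mult_0 V_intros) simp
  then show ?thesis
    by (simp only: summand_def mult_ac)
qed

text \<open>With \<open>y = q^(4r+1)\<close>, the congruence \<open>q^(4*rho+1) \<simeq> 1\<close> turns \<open>1 - q^(4(rho-r))\<close> into \<open>1 - 1/y\<close>.\<close>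
lemma qfactor_reflect:
  assumes "r < rho 1" shows "q ^ 3 * qfactor 1 r * qfactor 1 (rho 1 - Suc r) \<simeq> 1"
proof -
  have dvd: "d dvd 4 * rho 1 + 1" by (rule rho_dvd)
  define j where "j = rho 1 - Suc r"
  have j: "rho 1 = r + Suc j" using assms by (simp add: j_def)
  have jr: "Suc j < d" "Suc r < d" using j rho_less[of 1] by auto
  \<comment> \<open>The pairs \<open>a, e\<close> and \<open>b, c\<close> are inverse to each other
    modulo \<open>\<pi>\<close>, since both exponent sums are \<open>4 * rho 1 + 1\<close>. Hence
    \<open>a(1-e)\<close> and \<open>b(1-c)\<close> become \<open>-(1-a)\<close> and
    \<open>-(1-b)\<close>, and numerators cancel against denominators.\<close>
  define a b c e where "a = q ^ (4 * r + 1)" and "b = q ^ (4 * r + 4)" and "c = q ^ (4 * j + 1)" and "e = q ^ (4 * j + 4)"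
  have "a * e = q ^ (4 * rho 1 + 1)" "b * c = q ^ (4 * rho 1 + 1)"
    by (simp_all add: a_def b_def c_def e_def j power_add[symmetric] add_ac del: One_nat_def)
  then have ae: "a * e \<simeq> 1" and bc: "b * c \<simeq> 1"
    using q_cg_1[OF dvd] by auto
  have V: "a \<in> V" "b \<in> V" "c \<in> V" "e \<in> V" "inverse (1 - b) \<in> V" "inverse (1 - e) \<in> V"
    using den_unit[OF jr(1), of 0] den_unit[OF jr(2), of 0]
    by (auto simp: a_def b_def c_def e_def intro!: V_intros)
  have nz: "1 - b \<noteq> 0" "1 - e \<noteq> 0"
    unfolding b_def e_def by (intro q_pow_neq_1; simp)+
  have "4 * r + 4 = 3 + (4 * r + 1)" by simp
  then have b3: "b = q ^ 3 * a" unfolding a_def b_def by (simp only: power_add)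
  have "b * (1 - c) - (b - 1) \<simeq> 0" "a * (1 - e) - (a - 1) \<simeq> 0"
    using ae bc cg_sym by (auto simp: algebra_simps cg_0_iff[of _ 1, symmetric] cg_0_iff[of 1, symmetric])
  then have 1: "b * (1 - c) \<simeq> - (1 - b)" "a * (1 - e) \<simeq> - (1 - a)"
    by (simp_all add: cg_0_iff[of "b * _"] cg_0_iff[of "a * _"])
  have "b * (1 - a) * (1 - c) = (1 - a) * (b * (1 - c))" by (simp only: mult_ac)
  also have "\<dots> \<simeq> (1 - a) * (- (1 - b))"
    using V by (intro cg_mult_left 1 V_diff V_1)
  also have "\<dots> = (1 - b) * (- (1 - a))" by algebra
  also have "\<dots> \<simeq> (1 - b) * (a * (1 - e))"
    using V by (intro cg_mult_left cg_sym[OF 1(2)] V_diff V_1)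
  finally have "inverse (1 - b) * inverse (1 - e) * (b * (1 - a) * (1 - c)) \<simeq>
      inverse (1 - b) * inverse (1 - e) * ((1 - b) * (a * (1 - e)))"
    using V by (intro cg_mult_left V_mult)
  also have "\<dots> = a" using nz by (simp add: divide_simps)
  also have "inverse (1 - b) * inverse (1 - e) * (b * (1 - a) * (1 - c)) =
      b * (((1 - a) * inverse (1 - b)) * ((1 - c) * inverse (1 - e)))"
    by (simp only: mult_ac)
  also have "\<dots> = (q ^ 3 * a) * (qfactor 1 r * qfactor 1 j)"
    unfolding qfactor_def a_def[symmetric] b_def[symmetric] c_def[symmetric] e_def[symmetric] b3[symmetric] ..
  also have "\<dots> = a * (q ^ 3 * qfactor 1 r * qfactor 1 j)"
    by (simp only: mult_ac)
  finally have "a * (q ^ 3 * qfactor 1 r * qfactor 1 j) \<simeq> a * 1"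
    by simp
  then show ?thesis
    unfolding j_def[symmetric] by (rule cg_cancel) (unfold a_def, rule V_inverse_q_power, simp add: q0)
qed

text \<open>Passing from \<open>rho 1 - r\<close> to \<open>rho 1 - Suc r\<close> drops one factor
  of the product; by \<open>qfactor_reflect\<close> its inverse is
  \<open>q^3 * qfactor 1 r\<close>.\<close>

lemma qratio_reflect: "r \<le> rho 1 \<Longrightarrow> qratio 1 (rho 1 - r) \<simeq> qratio 1 (rho 1) * qratio 1 r * q ^ (3 * r)"
proof (induction r)
  case 0
  then show ?case by (simp add: qratio_eq_prod)
next
  case (Suc r)
  define j where "j = rho 1 - Suc r"
  have j: "rho 1 - r = Suc j" using Suc.prems by (simp add: j_def)
  have V: "qfactor 1 r \<in> V"
    using qfactor_V[of r 1 0] Suc.prems rho_less[of 1] by simp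
  have "qratio 1 j * 1 \<simeq> qratio 1 j * (q ^ 3 * qfactor 1 r * qfactor 1 j)"
    unfolding j_def using Suc.prems by (intro cg_mult_left cg_sym[OF qfactor_reflect] qratio_V) auto
  also have "\<dots> = (q ^ 3 * qfactor 1 r) * qratio 1 (rho 1 - r)"
    unfolding j by (simp add: qratio_eq_prod mult_ac)
  also have "\<dots> \<simeq> (q ^ 3 * qfactor 1 r) * (qratio 1 (rho 1) * qratio 1 r * q ^ (3 * r))"
    using Suc by (intro cg_mult_left V_mult V V_power V_q) auto
  also have "\<dots> = qratio 1 (rho 1) * qratio 1 (Suc r) * q ^ (3 * Suc r)"
    by (simp add: qratio_eq_prod power_add mult_ac)
  finally show ?case by (simp add: j_def)
qed

text \<open>At \<open>r = rho 1\<close> the left side of \<open>qratio_reflect\<close> is 1.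
  Squaring gives exponent \<open>6 * rho 1\<close>, of which \<open>4 * rho 1\<close> is traded for
  \<open>q^(-1)\<close>.\<close>

lemma qratio_rho: "qratio 1 (rho 1) ^ 4 * q ^ (2 * rho 1) \<simeq> q"
proof (rule cg_cancel)
  have "qratio 1 (rho 1) * qratio 1 (rho 1) * q ^ (3 * rho 1) \<simeq> 1"
    using cg_sym[OF qratio_reflect[OF order_refl]] by (simp add: qratio_eq_prod)
  then have "(qratio 1 (rho 1) * qratio 1 (rho 1) * q ^ (3 * rho 1)) ^ 2 \<simeq> 1 ^ 2"
    by (intro cg_power V_1)
  moreover have "(qratio 1 (rho 1) * qratio 1 (rho 1) * q ^ (3 * rho 1)) ^ 2 =
      q ^ (4 * rho 1) * (qratio 1 (rho 1) ^ 4 * q ^ (2 * rho 1))"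
  proof -
    have "3 * rho 1 * 2 = 4 * rho 1 + 2 * rho 1" by simp
    then have "(q ^ (3 * rho 1))^2 = q ^ (4 * rho 1) * q ^ (2 * rho 1)"
      by (metis power_add power_mult)
    moreover have "(x * x * y)^2 = x ^ 4 * y^2" for x y :: 'a by algebra
    ultimately show ?thesis by (simp only: mult_ac)
  qed
  moreover have "q ^ (4 * rho 1) * q \<simeq> 1"
    using q_cg_1[OF rho_dvd[of 1]] by (simp add: mult.commute)
  ultimately show "q ^ (4 * rho 1) * (qratio 1 (rho 1) ^ 4 * q ^ (2 * rho 1)) \<simeq> q ^ (4 * rho 1) * q"
    by (metis cg_trans cg_sym power_one)
qed (auto simp: V_inverse_q_power q0)

lemma summand_reflect:
  assumes "r \<le> rho 1" shows "summand (rho 1 - r) \<simeq> - summand r"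
proof (rule cg_cancel)
  define R where "R = rho 1"
  \<comment> \<open>The part \<open>q^(8r+1)\<close> of \<open>c\<close> turns
    \<open>1 - q^(8(R-r)+1)\<close> into \<open>q^(8r+1) - 1\<close> modulo \<open>\<pi>\<close>,
    because the exponents add up to \<open>2(4R+1)\<close>; the part \<open>q^(2r)\<close> completes
    \<open>q^(2(R-r))\<close> to the \<open>q^(2R)\<close> needed for
    \<open>qratio_rho\<close>.\<close>
  define c where "c = q ^ (10 * r + 1)"
  have r: "r \<le> R" using assms by (simp add: R_def)
  have "8 * r + 1 + (8 * (R - r) + 1) = 2 * (4 * R + 1)" "2 * r + 2 * (R - r) = 2 * R" using r by auto
  then have e: "q ^ (8 * r + 1) * q ^ (8 * (R - r) + 1) = q ^ (2 * (4 * R + 1))"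
     "q ^ (2 * r) * q ^ (2 * (R - r)) = q ^ (2 * R)"
    by (simp_all only: power_add[symmetric])
  have c: "c = q ^ (8 * r + 1) * q ^ (2 * r)" by (simp add: c_def power_add[symmetric])
  have d: "q ^ (8 * r + 1) - q ^ (8 * r + 1) * z = q ^ (8 * r + 1) * (1 - z)" for z
    by (simp only: right_diff_distrib mult_1_right)
  have "c * summand (R - r) = (q ^ (8 * r + 1) - q ^ (8 * r + 1) * q ^ (8 * (R - r) + 1)) *
      inverse (1 - q) * qratio 1 (R - r) ^ 4 * (q ^ (2 * r) * q ^ (2 * (R - r)))"
    unfolding summand_def c d by (simp only: mult_ac)
  also have "\<dots> \<simeq> (q ^ (8 * r + 1) - 1) * inverse (1 - q) * (qratio 1 R * qratio 1 r * q ^ (3 * r)) ^ 4 * q ^ (2 * R)"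
    unfolding e unfolding R_def using assms
    by (intro cg_mult cg_diff cg_power cg_refl qratio_reflect q_cg_1 V_intros V_diff dvd_mult rho_dvd)
  also have "\<dots> = (q ^ (8 * r + 1) - 1) * inverse (1 - q) * qratio 1 r ^ 4 * q ^ (12 * r) * (qratio 1 R ^ 4 * q ^ (2 * R))"
    by (simp add: power_mult_distrib power_mult[symmetric] mult_ac)
  also have "\<dots> \<simeq> (q ^ (8 * r + 1) - 1) * inverse (1 - q) * qratio 1 r ^ 4 * q ^ (12 * r) * q"
    unfolding R_def by (intro cg_mult_left qratio_rho V_intros V_diff)
  also have "\<dots> = c * (- summand r)"
  proof -
    have "12 * r + 1 = (10 * r + 1) + 2 * r" by simp
    then have *: "c * q ^ (2 * r) = q ^ (12 * r) * q"
      unfolding c_def by (metis power_add power_one_right)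
    have **: "- summand r = (q ^ (8 * r + 1) - 1) * inverse (1 - q) * qratio 1 r ^ 4 * q ^ (2 * r)"
      by (simp only: summand_def minus_mult_left minus_diff_eq)
    have "c * (- summand r) = (q ^ (8 * r + 1) - 1) * inverse (1 - q) * qratio 1 r ^ 4 * (c * q ^ (2 * r))"
      unfolding ** by (simp only: mult_ac)
    then show ?thesis unfolding * by (simp only: mult.assoc)
  qed
  finally show "c * summand (rho 1 - r) \<simeq> c * (- summand r)" by (simp add: R_def)
qed (auto simp: V_inverse_q_power q0 simp del: power_Suc)

section \<open>Vanishing of both sums modulo \<open>\<pi>\<close>\<close>

lemma sum_antisym_cg_0:
  fixes R :: nat
  assumes "\<And>k. k \<le> R \<Longrightarrow> f (R - k) \<simeq> - f k" shows "(\<Sum>k\<le>R. f k) \<simeq> 0"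
proof (rule cg_cancel)
  have "(\<Sum>k\<le>R. f k) = (\<Sum>k\<le>R. f (R - k))"
    by (rule sum.reindex_bij_witness[of _ "\<lambda>k. R - k" "\<lambda>k. R - k"]) auto
  also have "\<dots> \<simeq> (\<Sum>k\<le>R. - f k)"
    by (intro cg_sum assms) simp
  finally have "(\<Sum>k\<le>R. f k) \<simeq> - (\<Sum>k\<le>R. f k)"
    by (simp add: sum_negf)
  \<comment> \<open>A sum congruent to its own negative is killed by 2, and 2 is a unit of
    \<open>V\<close>.\<close>
  then show "2 * (\<Sum>k\<le>R. f k) \<simeq> 2 * 0"
    by (subst (asm) cg_0_iff) simp
qed (use V_half two in auto)

lemma sum_summand_rho: "(\<Sum>k\<le>rho 1. summand k) \<simeq> 0"
  by (intro sum_antisym_cg_0 summand_reflect)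

lemma sum_summand_block: "(\<Sum>r<d. summand r) \<simeq> 0"
proof -
  have d: "d = Suc (rho 1) + (d - Suc (rho 1))" using rho_less[of 1] by simp
  have "(\<Sum>r<d. summand r) = (\<Sum>r\<le>rho 1. summand r) + (\<Sum>r<d - Suc (rho 1). summand (Suc (rho 1) + r))"
    by (subst d) (simp only: sum_lessThan_block lessThan_Suc_atMost)
  also have "\<dots> \<simeq> 0 + (\<Sum>r<d - Suc (rho 1). 0)"
    using summand_cg_0[of _ 0] by (intro cg_add sum_summand_rho cg_sum) auto
  finally show ?thesis by simp
qed

lemma sum_summand_shift:
  assumes "m \<le> d" "(\<Sum>r<m. summand r) \<simeq> 0" shows "(\<Sum>r<m. summand (d * t + r)) \<simeq> 0"
proof -
  have "(\<Sum>r<m. summand (d * t + r)) \<simeq> (\<Sum>r<m. qratio 1 (d * t) ^ 4 * summand r)"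
    using assms(1) by (intro cg_sum summand_shift) auto
  also have "\<dots> = (\<Sum>r<m. summand r) * qratio 1 (d * t) ^ 4"
    by (subst sum_distrib_left[symmetric]) (rule mult.commute)
  also have "\<dots> \<simeq> 0"
    by (intro cg_mult_0 assms(2) V_intros)
  finally show ?thesis .
qed

lemma sum_summand_blocks: "(\<Sum>k<d * t. summand k) \<simeq> 0"
proof (induction t)
  case (Suc t)
  have "(\<Sum>k<d * Suc t. summand k) = (\<Sum>k<d * t. summand k) + (\<Sum>r<d. summand (d * t + r))"
    by (metis sum_lessThan_block mult_Suc_right add.commute)
  also have "\<dots> \<simeq> 0 + 0"
    by (intro cg_add Suc.IH sum_summand_shift sum_summand_block) simp
  finally show ?case by simp
qed simp

lemma sum_summand_full_cg_0: "(\<Sum>k<4 * N + 1. summand k) \<simeq> 0"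
  using d_dvd sum_summand_blocks by (elim dvdE) simp

lemma sum_summand_cg_0: "(\<Sum>k\<le>N. summand k) \<simeq> 0"
proof -
  \<comment> \<open>\<open>rho 1\<close> is \<open>N mod d\<close>, so the truncated sum consists of
    full blocks and a last block that ends exactly where the antisymmetric range ends.\<close>
  have "N = d * (N div d) + rho 1"
    by (simp add: rho_def)
  then have "{..N} = {..<d * (N div d) + Suc (rho 1)}"
    by (simp add: lessThan_Suc_atMost[symmetric])
  then have "(\<Sum>k\<le>N. summand k) = (\<Sum>k<d * (N div d). summand k) + (\<Sum>r<Suc (rho 1). summand (d * (N div d) + r))"
    by (simp only: sum_lessThan_block)
  also have "\<dots> \<simeq> 0 + 0"
    using rho_less[of 1] sum_summand_rho
    by (intro cg_add sum_summand_blocks sum_summand_shift) (simp_all add: lessThan_Suc_atMost)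
  finally show ?thesis by simp
qed

definition closed_form :: 'a where
  "closed_form = qratio 2 N * ((1 - q ^ (4 * N + 1)) * inverse (1 - q)) * inverse (q ^ N)"

lemma closed_form_cg_0: "closed_form \<simeq> 0"
proof -
  have "(1 - q ^ (4 * N + 1)) * (qratio 2 N * inverse (1 - q) * inverse (q ^ N)) \<simeq> 0"
    by (intro cg_mult_0 one_minus_q_cg_0 d_dvd V_intros V_inverse_q_power)
  then show ?thesis by (simp only: closed_form_def mult_ac)
qed

subsection \<open>The first-order term of the deformation\<close>

text \<open>This is \<open>2 - a - 1/a\<close> for \<open>a = q^d\<close>, so that
  \<open>(1 - a q^m) (1 - q^m/a) = (1 - q^m)^2 + x0 q^m\<close>.\<close>
definition x0 :: 'a where
  "x0 = - ((1 - q ^ d) ^ 2) * inverse (q ^ d)"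

definition h :: "nat \<Rightarrow> 'a" where
  "h m = q ^ m * inverse (1 - q ^ m) ^ 2"

text \<open>The derivative at \<open>x = 0\<close> of the product \<open>deform\<close> below with \<open>x0\<close> replaced by \<open>x\<close>.\<close>
definition deriv_sum :: "nat \<Rightarrow> 'a" where
  "deriv_sum k = (\<Sum>j<k. h (4 * j + 1) - h (4 * j + 4))"

text \<open>The factor by which replacing two copies of \<open>(q;q^4)_k / (q^4;q^4)_k\<close> by
  their versions shifted with \<open>a = q^d\<close> and \<open>1/a\<close> changes the
  summand.\<close>

definition deform :: "nat \<Rightarrow> 'a" where
  "deform k = (\<Prod>j<k. (1 + x0 * h (4 * j + 1)) * inverse (1 + x0 * h (4 * j + 4)))"

lemma x0_pi: "\<exists>z\<in>V. x0 = \<pi>^2 * z"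
proof -
  obtain z where "z \<in> V" "1 - q ^ d = \<pi> * z" using pi_dvd by blast
  then show ?thesis
    by (intro bexI[of _ "- (z ^ 2 * inverse (q ^ d))"] V_uminus V_mult V_power V_inverse_q_power)
       (auto simp: x0_def power_mult_distrib)
qed

lemma h_V: "\<not> d dvd m \<Longrightarrow> h m \<in> V"
  unfolding h_def by (intro V_mult V_power V_q V_unit)

lemma one_plus_x0_h:
  assumes "m > 0"
  shows "1 + x0 * h m = (1 - q ^ d * q ^ m) * (1 - q ^ m / q ^ d) / (1 - q ^ m) ^ 2"
  unfolding x0_def h_def
  by (intro shifted_factor_identity q_pow_neq_1 assms) (simp add: q0)

text \<open>Up to powers of \<open>q\<close> this is
  \<open>(1 - q^(d+m)) (1 - q^(d-m)) / (1 - q^m)^2\<close>, and \<open>d\<close> divides neither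
  \<open>d + m\<close> nor \<open>d - m\<close>.\<close>

lemma one_plus_x0_h_unit:
  assumes "m > 0" "m < d"
  shows "inverse (1 + x0 * h m) \<in> V" "1 + x0 * h m \<noteq> 0"
proof -
  have e: "q ^ d = q ^ (d - m) * q ^ m" using assms by (simp add: power_add[symmetric])
  have nz: "1 - q ^ (d - m) \<noteq> 0" "1 - q ^ (d + m) \<noteq> 0" "1 - q ^ m \<noteq> 0"
    using assms by (intro q_pow_neq_1; simp)+
  have "1 - q ^ m / q ^ d = - ((1 - q ^ (d - m)) * inverse (q ^ (d - m)))"
    unfolding e using q0 by (simp add: field_simps)
  then have eq: "1 + x0 * h m = - ((1 - q ^ (d + m)) * (1 - q ^ (d - m)) * inverse (q ^ (d - m))) / (1 - q ^ m) ^ 2"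
    using one_plus_x0_h[OF assms(1)] by (simp add: power_add)
  have "inverse (1 + x0 * h m) = - (inverse (1 - q ^ (d + m)) * inverse (1 - q ^ (d - m)) * q ^ (d - m) * (1 - q ^ m) ^ 2)"
    unfolding eq by (simp add: field_simps)
  also have "\<dots> \<in> V"
    using assms by (intro V_uminus V_intros V_unit) (auto dest: dvd_imp_le simp: nat_dvd_not_less)
  finally show "inverse (1 + x0 * h m) \<in> V" .
  show "1 + x0 * h m \<noteq> 0"
    unfolding eq using nz q0 by simp
qed

text \<open>The Taylor expansion in \<open>x0\<close> to first order, with remainder in
  \<open>V\<close>. The bound \<open>k \<le> N\<close> keeps all indices \<open>4j+1\<close> and
  \<open>4j+4\<close> below \<open>d\<close>, where \<open>h\<close> and the inverted factors are
  integral.\<close>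

lemma deform_expand:
  assumes "d = 4 * N + 1" "k \<le> N"
  shows "deriv_sum k \<in> V \<and> (\<exists>z\<in>V. deform k = 1 + x0 * deriv_sum k + x0^2 * z)"
  using assms(2)
proof (induction k)
  case 0
  show ?case by (auto simp: deform_def deriv_sum_def V_0 intro: bexI[of _ 0])
next
  case (Suc k)
  then obtain z where z: "z \<in> V" "deform k = 1 + x0 * deriv_sum k + x0^2 * z" and deriv_sum: "deriv_sum k \<in> V" by auto
  define a b where "a = h (4 * k + 1)" and "b = h (4 * k + 4)"
  have "\<not> d dvd 4 * k + 1" "\<not> d dvd 4 * k + 4"
    using Suc.prems assms(1) by (auto simp: nat_dvd_not_less)
  then have ab: "a \<in> V" "b \<in> V" by (auto simp: a_def b_def h_V simp del: One_nat_def)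
  have x: "x0 \<in> V"
    using x0_pi V_pi by (metis V_mult V_power)
  define u where "u = inverse (1 + x0 * b)"
  have u: "u \<in> V" "(1 + x0 * b) * u = 1"
    using one_plus_x0_h_unit[of "4 * k + 4"] Suc.prems assms(1) by (auto simp: u_def b_def)
  have "deform (Suc k) = deform k * ((1 + x0 * a) * u)"
    by (simp add: deform_def a_def b_def u_def)
  \<comment> \<open>Keeping the factor \<open>(1 + x0 * b) * u\<close>, which equals 1, makes this a
    polynomial identity in \<open>u\<close>.\<close>
  also have "(1 + x0 * a) * u = (1 + x0 * b) * u * (1 + x0 * (a - b)) + x0^2 * (- (b * (a - b) * u))"
    by algebra
  also have "\<dots> = 1 + x0 * (a - b) + x0^2 * (- (b * (a - b) * u))"
    by (simp only: u(2) mult_1_left)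
  also have "deform k * \<dots> = 1 + x0 * (deriv_sum k + (a - b)) + x0^2 *
     (z + deriv_sum k * (a - b) + x0 * z * (a - b) - (b * (a - b) * u) * deform k)"
    unfolding z(2) by algebra
  also have "deriv_sum k + (a - b) = deriv_sum (Suc k)" by (simp add: deriv_sum_def a_def b_def)
  finally have *: "deform (Suc k) = 1 + x0 * deriv_sum (Suc k) + x0^2 *
     (z + deriv_sum k * (a - b) + x0 * z * (a - b) - (b * (a - b) * u) * deform k)" .
  have "deform k \<in> V" unfolding z(2) by (intro V_add V_mult V_power V_1 x deriv_sum z)
  then have "z + deriv_sum k * (a - b) + x0 * z * (a - b) - (b * (a - b) * u) * deform k \<in> V"
    by (intro V_add V_diff V_mult ab x deriv_sum z u)
  moreover have "deriv_sum (Suc k) \<in> V"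
    using deriv_sum ab by (simp add: deriv_sum_def a_def b_def V_add V_diff)
  ultimately show ?case using * by blast
qed

text \<open>The function \<open>y / (1 - y)^2\<close> is invariant under
  \<open>y \<mapsto> 1/y\<close>, and \<open>q^(d-m)\<close> is inverse to \<open>q^m\<close> modulo
  \<open>\<pi>\<close>.\<close>

lemma h_reflect:
  assumes "0 < m" "m < d" shows "h (d - m) \<simeq> h m"
proof -
  define y y' where "y = q ^ m" and "y' = q ^ (d - m)"
  have yy: "y * y' = q ^ d" using assms by (simp add: y_def y'_def power_add[symmetric])
  have nz: "1 - y \<noteq> 0" "1 - y' \<noteq> 0"
    using assms unfolding y_def y'_def by (intro q_pow_neq_1; simp)+
  have V: "y \<in> V" "y' \<in> V" "inverse (1 - y) \<in> V" "inverse (1 - y') \<in> V"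
    using assms unfolding y_def y'_def by (auto intro!: V_power V_q V_unit simp: nat_dvd_not_less)
  have "(1 - q ^ d) * ((y' - y) * inverse (1 - y) ^ 2 * inverse (1 - y') ^ 2) \<simeq> 0"
    by (intro cg_mult_0 one_minus_q_cg_0 V_mult V_power V V_diff) simp
  moreover have "y' * inverse (1 - y') ^ 2 - y * inverse (1 - y) ^ 2 =
      (1 - q ^ d) * ((y' - y) * inverse (1 - y) ^ 2 * inverse (1 - y') ^ 2)"
    unfolding yy[symmetric] using nz by (rule reflected_difference_identity)
  ultimately show ?thesis
    unfolding h_def y_def y'_def by (subst cg_0_iff) simp
qed

text \<open>Up to \<open>\<simeq>\<close>, \<open>deriv_sum k\<close> is the symmetric expression \<open>H N - H (N - k) - H k\<close> in the partial sums
  \<open>H\<close> of \<open>h (4 * i)\<close>.\<close>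
lemma deriv_sum_reflect:
  assumes "d = 4 * N + 1" "k \<le> N" shows "deriv_sum (N - k) \<simeq> deriv_sum k"
proof -
  define H where "H k = (\<Sum>j<k. h (4 * j + 4))" for k
  have *: "deriv_sum k \<simeq> H N - H (N - k) - H k" if "k \<le> N" for k
    using that
  proof (induction k)
    case 0
    then show ?case by (simp add: deriv_sum_def H_def)
  next
    case (Suc k)
    have "d - (4 * k + 1) = 4 * (N - Suc k) + 4" using Suc.prems assms(1) by simp
    then have "h (4 * k + 1) \<simeq> h (4 * (N - Suc k) + 4)"
      using h_reflect[of "4 * k + 1"] Suc.prems assms(1) cg_sym by simp
    then have *: "deriv_sum k + (h (4 * k + 1) - h (4 * k + 4)) \<simeq>
       (H N - H (N - k) - H k) + (h (4 * (N - Suc k) + 4) - h (4 * k + 4))"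
      using Suc by (intro cg_add cg_diff cg_refl) auto
    have "N - k = Suc (N - Suc k)" using Suc.prems by simp
    then have "H (N - k) = H (N - Suc k) + h (4 * (N - Suc k) + 4)"
      by (simp only: H_def sum.lessThan_Suc)
    moreover have "H (Suc k) = H k + h (4 * k + 4)" by (simp add: H_def)
    ultimately have "(H N - H (N - k) - H k) + (h (4 * (N - Suc k) + 4) - h (4 * k + 4)) =
        H N - H (N - Suc k) - H (Suc k)" by (simp only:) simp
    moreover have "deriv_sum (Suc k) = deriv_sum k + (h (4 * k + 1) - h (4 * k + 4))"
      by (simp only: deriv_sum_def sum.lessThan_Suc)
    ultimately show ?case using * by (simp only:)
  qed
  have "deriv_sum (N - k) \<simeq> H N - H (N - k) - H k"
    using *[of "N - k"] assms(2) by (simp only: diff_diff_cancel diff_le_self diff_diff_add add.commute)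
  then show ?thesis
    using *[OF assms(2), THEN cg_sym] by (rule cg_trans)
qed

lemma sum_summand_deriv:
  assumes "d = 4 * N + 1" shows "(\<Sum>k\<le>N. summand k * deriv_sum k) \<simeq> 0"
proof (rule sum_antisym_cg_0)
  fix k assume k: "k \<le> N"
  have "rho 1 = N" by (rule rho_1[OF assms])
  then have "summand (N - k) * deriv_sum (N - k) \<simeq> - summand k * deriv_sum k"
    using k summand_reflect[of k] deriv_sum_reflect[OF assms k] deform_expand[OF assms, of "N - k"]
    by (intro cg_mult V_uminus summand_V) auto
  then show "summand (N - k) * deriv_sum (N - k) \<simeq> - (summand k * deriv_sum k)" by simp
qed

text \<open>In the linear term \<open>x0\<close> supplies \<open>\<pi>^2\<close> and
  \<open>sum_summand_deriv\<close> a third \<open>\<pi>\<close>; the quadratic term already has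
  \<open>\<pi>^4\<close>.\<close>

lemma sum_summand_deform:
  assumes "d = 4 * N + 1" shows "\<exists>z\<in>V. (\<Sum>k\<le>N. summand k * deform k) - (\<Sum>k\<le>N. summand k) = \<pi>^3 * z"
proof -
  have "\<forall>k\<le>N. \<exists>z\<in>V. deform k = 1 + x0 * deriv_sum k + x0^2 * z"
    using deform_expand[OF assms] by blast
  then obtain z where z: "\<And>k. k \<le> N \<Longrightarrow> z k \<in> V" "\<And>k. k \<le> N \<Longrightarrow> deform k = 1 + x0 * deriv_sum k + x0^2 * z k"
    by metis
  obtain y where y: "y \<in> V" "x0 = \<pi>^2 * y" using x0_pi by blast
  obtain u where u: "u \<in> V" "(\<Sum>k\<le>N. summand k * deriv_sum k) = \<pi> * u"
    using sum_summand_deriv[OF assms] by (auto simp: cg_def)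
  define Z where "Z = (\<Sum>k\<le>N. summand k * z k)"
  have Z: "Z \<in> V" unfolding Z_def by (intro V_sum V_mult summand_V z) auto
  have "(\<Sum>k\<le>N. summand k * deform k) = (\<Sum>k\<le>N. summand k + x0 * (summand k * deriv_sum k) + x0^2 * (summand k * z k))"
    by (intro sum.cong refl) (simp add: z(2) algebra_simps)
  also have "\<dots> = (\<Sum>k\<le>N. summand k) + x0 * (\<pi> * u) + x0^2 * Z"
    by (simp add: sum.distrib sum_distrib_left[symmetric] u(2) Z_def)
  finally have "(\<Sum>k\<le>N. summand k * deform k) - (\<Sum>k\<le>N. summand k) = x0 * (\<pi> * u) + x0^2 * Z"
    by simp
  also have "\<dots> = \<pi>^3 * (y * u + \<pi> * y^2 * Z)"
    unfolding y(2) by algebra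
  finally have "(\<Sum>k\<le>N. summand k * deform k) - (\<Sum>k\<le>N. summand k) = \<pi>^3 * (y * u + \<pi> * y^2 * Z)" .
  moreover have "y * u + \<pi> * y^2 * Z \<in> V" by (intro V_add V_mult V_power V_pi y u Z)
  ultimately show ?thesis by blast
qed

text \<open>Here \<open>rho 1 = N\<close>, so each of the four equal quotients in the summand is
  divisible by \<open>\<pi>\<close>.\<close>

lemma summand_tail:
  assumes "d = 4 * N + 1" "N < k" "k < d" shows "\<exists>z\<in>V. summand k = \<pi>^3 * z"
proof -
  have "rho 1 = N" by (rule rho_1[OF assms(1)])
  then obtain z where z: "z \<in> V" "qratio 1 k = \<pi> * z"
    using qratio_cg_0[of 1 k 0] assms by (auto simp: cg_def simp del: One_nat_def)
  define c where "c = (1 - q ^ (8 * k + 1)) * inverse (1 - q) * q ^ (2 * k)"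
  have c: "c \<in> V" unfolding c_def by (intro V_intros)
  have "summand k = \<pi>^3 * (\<pi> * z ^ 4 * c)"
    unfolding summand_def z(2) c_def power_mult_distrib by (simp add: power3_eq_cube power4_eq_xxxx)
  moreover have "\<pi> * z ^ 4 * c \<in> V" by (intro V_mult V_power V_pi z c)
  ultimately show ?thesis by blast
qed

subsection \<open>Exact evaluation of the deformed sum\<close>

lemma q_power_inj: "q ^ i = q ^ j \<Longrightarrow> i = j"
proof (induction i j rule: linorder_wlog)
  case (le i j)
  then have "j = i + (j - i)" by simp
  then have "q ^ j = q ^ i * q ^ (j - i)" by (metis power_add)
  then have "q ^ i * q ^ (j - i) = q ^ i * 1" using le by simp
  then show ?case using q_root[of "j - i"] q0 le by force
qed simp

lemma qpoch_q_nonzero: "s > 0 \<Longrightarrow> qpoch (q ^ s) (q ^ 4) k \<noteq> 0"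
  using q_root[of "s + 4 * _"] by (intro qpoch_nonzero) (auto simp: power_add power_mult)

lemma qpoch_shifted_pair:
  assumes "s > 0"
  shows "qpoch (q ^ s * q ^ d) (q ^ 4) k * qpoch (q ^ s / q ^ d) (q ^ 4) k =
    qpoch (q ^ s) (q ^ 4) k ^ 2 * (\<Prod>j<k. 1 + x0 * h (4 * j + s))"
  unfolding qpoch_def prod.distrib[symmetric] prod_power_distrib
proof (rule prod.cong)
  fix j assume "j \<in> {..<k}"
  have pos: "4 * j + s > 0" using assms by simp
  have e: "q ^ s * (q ^ 4) ^ j = q ^ (4 * j + s)" by (simp add: power_add power_mult)
  have e1: "q ^ s * q ^ d * (q ^ 4) ^ j = q ^ d * q ^ (4 * j + s)"
    "q ^ s / q ^ d * (q ^ 4) ^ j = q ^ (4 * j + s) / q ^ d"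
    unfolding e[symmetric] by (simp_all add: mult_ac)
  show "(1 - q ^ s * q ^ d * (q ^ 4) ^ j) * (1 - q ^ s / q ^ d * (q ^ 4) ^ j) =
      (1 - q ^ s * (q ^ 4) ^ j)^2 * (1 + x0 * h (4 * j + s))"
    unfolding e e1 one_plus_x0_h[OF pos] using q_pow_neq_1[OF pos] by simp
qed simp

context
  assumes d: "d = 4 * N + 1"
begin

text \<open>The specialization \<open>p = q^4\<close>, \<open>A = q\<close>, \<open>C = a q\<close>
  with \<open>a = q^d\<close>: termination is automatic because \<open>p^(-N) = q/a\<close>, the
  denominator parameters become \<open>q^4/a\<close> and \<open>q^4 a\<close>, and the argument is
  \<open>q^2\<close>.\<close>

lemma vwp_parameters:
  "inverse ((q ^ 4) ^ N) = q / q ^ d"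
  "q * q ^ 4 / (q * q ^ d) = q ^ 4 / q ^ d"
  "q * (q ^ 4) ^ Suc N = q ^ 4 * q ^ d"
  "(q ^ 4) ^ Suc N / (q * q ^ d) = q ^ 2"
proof -
  have dd: "q ^ d = (q ^ 4) ^ N * q"
    by (simp add: d power_mult)
  show "inverse ((q ^ 4) ^ N) = q / q ^ d" using q0 by (simp add: dd divide_simps)
  show "q * q ^ 4 / (q * q ^ d) = q ^ 4 / q ^ d" using q0 by simp
  show "q * (q ^ 4) ^ Suc N = q ^ 4 * q ^ d" by (simp add: dd mult_ac)
  show "(q ^ 4) ^ Suc N / (q * q ^ d) = q ^ 2"
    using q0 by (simp add: dd divide_simps) algebra
qed

lemma vwp_eq_summand_deform: "vwp (q ^ 4) q (q * q ^ d) N k = summand k * deform k"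
proof -
  define X where "X = (\<Prod>j<k. 1 + x0 * h (4 * j + 1))"
  define Y where "Y = (\<Prod>j<k. 1 + x0 * h (4 * j + 4))"
  define u v where "u = qpoch q (q ^ 4) k" and "v = qpoch (q ^ 4) (q ^ 4) k"
  have deform: "deform k = X / Y"
    unfolding deform_def X_def Y_def divide_inverse[symmetric] by (rule prod_dividef)
  have e: "q * (q ^ 4) ^ (2 * k) = q ^ (8 * k + 1)" "(q ^ 2) ^ k = q ^ (2 * k)"
    by (simp_all add: power_mult[symmetric])
  have n: "qpoch (q * q ^ d) (q ^ 4) k * qpoch (q / q ^ d) (q ^ 4) k = u ^ 2 * X"
    using qpoch_shifted_pair[of 1 k] by (simp add: u_def X_def)
  have m: "qpoch (q ^ 4 / q ^ d) (q ^ 4) k * qpoch (q ^ 4 * q ^ d) (q ^ 4) k = v ^ 2 * Y"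
    using qpoch_shifted_pair[of 4 k] by (simp add: v_def Y_def mult.commute)
  have "vwp (q ^ 4) q (q * q ^ d) N k =
      (1 - q ^ (8 * k + 1)) / (1 - q) * (u ^ 2 * (u ^ 2 * X)) / (v ^ 2 * (v ^ 2 * Y)) * q ^ (2 * k)"
    unfolding vwp_def vwp_parameters e mult.assoc unfolding n m u_def v_def ..
  also have "\<dots> = summand k * deform k"
    unfolding summand_def qratio_def deform power_one_right u_def[symmetric] v_def[symmetric]
    by (simp add: power2_eq_square power4_eq_xxxx divide_inverse mult_ac)
  finally show ?thesis .
qed

lemma vwp_closed_form:
  "qpoch (q * q ^ 4) (q ^ 4) N * qpoch (q ^ 4 / (q * q ^ d)) (q ^ 4) N /
   (qpoch (q ^ 4) (q ^ 4) N * qpoch (q * q ^ 4 / (q * q ^ d)) (q ^ 4) N) = closed_form"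
proof -
  have rev: "qpoch (q ^ s / q ^ d) (q ^ 4) N = (\<Prod>i<N. - (1 - q ^ (4 * i + (5 - s))) / q ^ (4 * i + (5 - s)))"
    if "s \<le> 4" for s
  proof -
    have "qpoch (q ^ s / q ^ d) (q ^ 4) N = (\<Prod>i<N. 1 - q ^ s / q ^ d * (q ^ 4) ^ (N - Suc i))"
      unfolding qpoch_def by (rule prod.nat_diff_reindex[symmetric])
    also have "\<dots> = (\<Prod>i<N. - (1 - q ^ (4 * i + (5 - s))) / q ^ (4 * i + (5 - s)))"
    proof (rule prod.cong)
      fix i assume "i \<in> {..<N}"
      \<comment> \<open>Reading the product backwards turns its entries into reciprocals of positive
        powers of \<open>q\<close>, as the exponents add up to \<open>4N + 1 = d\<close>.\<close>
      then have "s + 4 * (N - Suc i) + (4 * i + (5 - s)) = d" using that d by simp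
      then have e: "q ^ d = q ^ s * (q ^ 4) ^ (N - Suc i) * q ^ (4 * i + (5 - s))"
        by (metis power_add power_mult)
      show "1 - q ^ s / q ^ d * (q ^ 4) ^ (N - Suc i) = - (1 - q ^ (4 * i + (5 - s))) / q ^ (4 * i + (5 - s))"
        unfolding e using q0 by (simp add: field_simps)
    qed simp
    finally show ?thesis .
  qed
  have e3: "q ^ 4 / (q * q ^ d) = q ^ 3 / q ^ d" using q0 by (simp add: power_numeral_reduce)
  define U where "U = qpoch (q ^ 4 / q ^ d) (q ^ 4) N"
  have U0: "U \<noteq> 0"
    unfolding U_def rev[of 4, simplified] using q_pow_neq_1[of "4 * _ + 1"] q0 by (auto simp: prod_zero_iff)
  \<comment> \<open>Compares the reversed products for \<open>s = 3\<close> and \<open>s = 4\<close>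
    factor by factor; the single \<open>q\<close> on the left accumulates to the power
    \<open>q^N\<close> of the closed form.\<close>
  have factor: "- (1 - q ^ (4 * i + 2)) / q ^ (4 * i + 2) * (1 - q * (q ^ 4) ^ i) * q =
      (1 - q ^ 2 * (q ^ 4) ^ i) * (- (1 - q ^ (4 * i + 1)) / q ^ (4 * i + 1))" for i
  proof -
    have e: "q ^ (4 * i + 1) = q * (q ^ 4) ^ i" "q ^ (4 * i + 2) = q ^ 2 * (q ^ 4) ^ i"
      by (simp_all add: power_add power_mult power2_eq_square)
    show ?thesis unfolding e using q0 by (simp add: divide_simps) algebra
  qed
  have rev3: "qpoch (q ^ 3 / q ^ d) (q ^ 4) N = (\<Prod>i<N. - (1 - q ^ (4 * i + 2)) / q ^ (4 * i + 2))"
    using rev[of 3] by simp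
  have rev4: "U = (\<Prod>i<N. - (1 - q ^ (4 * i + 1)) / q ^ (4 * i + 1))"
    using rev[of 4] by (simp add: U_def)
  have qN: "q ^ N = (\<Prod>i<N. q)" by simp
  have 1: "qpoch (q ^ 3 / q ^ d) (q ^ 4) N * qpoch q (q ^ 4) N * q ^ N = qpoch (q ^ 2) (q ^ 4) N * U"
    unfolding rev3 rev4 qN unfolding qpoch_def prod.distrib[symmetric] factor ..
  \<comment> \<open>Shifting the base from \<open>q\<close> to \<open>q^5\<close> exchanges the
    first factor for a new last one, which produces the \<open>q\<close>-integer
    \<open>[n]\<close>.\<close>
  have 2: "(1 - q) * qpoch (q * q ^ 4) (q ^ 4) N = qpoch q (q ^ 4) N * (1 - q ^ (4 * N + 1))"
    unfolding qpoch_Suc_left[symmetric] qpoch_Suc by (simp add: power_mult)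
  have "(1 - q) * q ^ N * (qpoch (q * q ^ 4) (q ^ 4) N * qpoch (q ^ 3 / q ^ d) (q ^ 4) N) =
      ((1 - q) * qpoch (q * q ^ 4) (q ^ 4) N) * (qpoch (q ^ 3 / q ^ d) (q ^ 4) N * q ^ N)"
    by (simp only: mult_ac)
  also have "\<dots> = (1 - q ^ (4 * N + 1)) * (qpoch (q ^ 3 / q ^ d) (q ^ 4) N * qpoch q (q ^ 4) N * q ^ N)"
    unfolding 2 by (simp only: mult_ac)
  finally have 3: "(1 - q) * q ^ N * (qpoch (q * q ^ 4) (q ^ 4) N * qpoch (q ^ 3 / q ^ d) (q ^ 4) N) =
      (1 - q ^ (4 * N + 1)) * (qpoch (q ^ 2) (q ^ 4) N * U)"
    unfolding 1 .
  have "1 - q \<noteq> 0" "qpoch (q ^ 4) (q ^ 4) N \<noteq> 0"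
    using q_pow_neq_1[of 1] qpoch_q_nonzero[of 4] by auto
  then show ?thesis
    unfolding closed_form_def qratio_def e3 vwp_parameters U_def[symmetric] using 3 U0 q0
    by (simp add: divide_simps) (simp only: mult_ac)
qed

lemma sum_summand_deform_eq: "(\<Sum>k\<le>N. summand k * deform k) = closed_form"
proof -
  have "(\<Sum>k\<le>N. vwp (q ^ 4) q (q * q ^ d) N k) = closed_form"
  proof (subst vwp_sum)
    fix j :: nat
    show "j > 0 \<Longrightarrow> (q ^ 4) ^ j \<noteq> 1" using q_root[of "4 * j"] by (simp add: power_mult)
    have e: "q * (q ^ 4) ^ j = q ^ (4 * j + 1)" "q * q ^ d = q ^ (4 * N + 2)"
      by (simp_all add: power_mult d)
    show "q * (q ^ 4) ^ j \<noteq> 1" unfolding e by (rule q_root) simp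
    show "q * (q ^ 4) ^ j \<noteq> q * q ^ d"
    proof
      assume "q * (q ^ 4) ^ j = q * q ^ d"
      \<comment> \<open>The two exponents have different parity, so the denominator
        \<open>A p/C\<close> causes no division by zero.\<close>
      then have "4 * j + 1 = 4 * N + 2" unfolding e by (rule q_power_inj)
      then show False by presburger
    qed
  qed (use q0 vwp_closed_form in auto)
  then show ?thesis by (simp only: vwp_eq_summand_deform)
qed

theorem sum_summand_cg_cube:
  "\<exists>z\<in>V. (\<Sum>k\<le>N. summand k) - closed_form = \<pi>^3 * z"
  "\<exists>z\<in>V. (\<Sum>k<4 * N + 1. summand k) - closed_form = \<pi>^3 * z"
proof -
  obtain z where z: "z \<in> V" "(\<Sum>k\<le>N. summand k) - closed_form = \<pi>^3 * (- z)"
    using sum_summand_deform[OF d] unfolding sum_summand_deform_eq by (auto simp: algebra_simps)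
  then show "\<exists>z\<in>V. (\<Sum>k\<le>N. summand k) - closed_form = \<pi>^3 * z" using V_uminus by blast
  have "\<forall>r<3 * N. \<exists>z\<in>V. summand (Suc N + r) = \<pi>^3 * z"
    using summand_tail[OF d] d by auto
  then obtain f where f: "\<And>r. r < 3 * N \<Longrightarrow> f r \<in> V" "\<And>r. r < 3 * N \<Longrightarrow> summand (Suc N + r) = \<pi>^3 * f r"
    by metis
  have "4 * N + 1 = Suc N + 3 * N" by simp
  then have "(\<Sum>k<4 * N + 1. summand k) = (\<Sum>k\<le>N. summand k) + (\<Sum>r<3 * N. summand (Suc N + r))"
    by (simp only: sum_lessThan_block lessThan_Suc_atMost)
  also have "(\<Sum>r<3 * N. summand (Suc N + r)) = \<pi>^3 * (\<Sum>r<3 * N. f r)"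
    unfolding sum_distrib_left by (intro sum.cong refl f) simp
  finally have "(\<Sum>k<4 * N + 1. summand k) - closed_form = \<pi>^3 * (- z + (\<Sum>r<3 * N. f r))"
    using z(2) by (simp only: distrib_left) simp
  moreover have "- z + (\<Sum>r<3 * N. f r) \<in> V"
    by (intro V_add V_uminus V_sum z f) simp
  ultimately show "\<exists>z\<in>V. (\<Sum>k<4 * N + 1. summand k) - closed_form = \<pi>^3 * z" by blast
qed

end

lemma summand_eq:
  "summand k = qint q (8 * k + 1) * qpoch q (q ^ 4) k ^ 4 / qpoch (q ^ 4) (q ^ 4) k ^ 4 * q ^ (2 * k)"
  by (simp add: summand_def qratio_def qint_def divide_inverse power_mult_distrib power_inverse mult_ac)

lemma closed_form_eq:
  "closed_form = qpoch (q ^ 2) (q ^ 4) N / qpoch (q ^ 4) (q ^ 4) N * qint q (4 * N + 1) * inverse (q ^ N)"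
  by (simp add: closed_form_def qratio_def qint_def divide_inverse mult_ac)

lemma sums_cg:
  "\<exists>z\<in>V. (\<Sum>k\<le>N. summand k) - closed_form = \<pi> * z" "\<exists>z\<in>V. (\<Sum>k<4 * N + 1. summand k) - closed_form = \<pi> * z"
  using cg_diff[OF sum_summand_cg_0 closed_form_cg_0] cg_diff[OF sum_summand_full_cg_0 closed_form_cg_0] by (simp_all add: cg_def)

end

section \<open>Cyclotomic polynomials\<close>

definition xpow_diff_one :: "nat \<Rightarrow> rat poly" where "xpow_diff_one n = monom 1 n - 1"

lemma xpow_diff_one_add: "xpow_diff_one (m + n) = xpow_diff_one m * monom 1 n + xpow_diff_one n"
  by (simp add: xpow_diff_one_def algebra_simps mult_monom)

lemma xpow_diff_one_0 [simp]: "xpow_diff_one 0 = 0"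
  by (simp add: xpow_diff_one_def one_poly_eq_simps)

lemma xpow_diff_one_nonzero: "n > 0 \<Longrightarrow> xpow_diff_one n \<noteq> 0"
  by (simp add: xpow_diff_one_def monom_eq_1_iff)

lemma dvd_xpow_diff_one_cancel:
  assumes "c dvd xpow_diff_one (m + n)" "c dvd xpow_diff_one m" shows "c dvd xpow_diff_one n"
  using assms by (metis xpow_diff_one_add dvd_add_right_iff dvd_mult2)

lemma xpow_diff_one_dvd: "d dvd n \<Longrightarrow> xpow_diff_one d dvd xpow_diff_one n"
proof (erule dvdE)
  fix k show "n = d * k \<Longrightarrow> xpow_diff_one d dvd xpow_diff_one n"
    by (induction k arbitrary: n) (auto simp: xpow_diff_one_add)
qed

text \<open>Euclid's algorithm on the exponents.\<close>

lemma dvd_xpow_diff_one_gcd: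
  assumes "c dvd xpow_diff_one m" "c dvd xpow_diff_one n" shows "c dvd xpow_diff_one (gcd m n)"
  using assms
proof (induction m n rule: gcd_nat_induct)
  case (step m n)
  have "c dvd xpow_diff_one (n * (m div n) + m mod n)" using step by simp
  moreover have "c dvd xpow_diff_one (n * (m div n))"
    using step.prems(2) xpow_diff_one_dvd[of n "n * (m div n)"] by (elim dvd_trans) simp
  ultimately have "c dvd xpow_diff_one (m mod n)" by (rule dvd_xpow_diff_one_cancel)
  then show ?case using step by (simp add: gcd_red_nat[of m n])
qed simp

lemma xpow_diff_one_squarefree:
  assumes "n > 0" "r * r dvd xpow_diff_one n" shows "is_unit r"
proof -
  obtain s where s: "xpow_diff_one n = r * r * s" using assms(2) by blast
  have "pderiv (xpow_diff_one n) = monom (of_nat n) (n - 1)"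
    by (simp add: xpow_diff_one_def pderiv_diff pderiv_monom)
  moreover have "r dvd pderiv (xpow_diff_one n)"
    unfolding s by (auto simp: pderiv_mult intro!: dvd_add)
  \<comment> \<open>Multiplying the derivative \<open>n X^(n-1)\<close> by \<open>X/n\<close>
    recovers \<open>X^n\<close>, and \<open>X^n - (X^n - 1) = 1\<close>.\<close>
  ultimately have "r dvd monom (of_nat n) (n - 1) * monom (1 / of_nat n) 1"
    by simp
  then have "r dvd monom 1 n"
    using assms(1) by (simp add: mult_monom)
  moreover have "r dvd xpow_diff_one n" unfolding s by simp
  ultimately have "r dvd monom 1 n - xpow_diff_one n" by (rule dvd_diff)
  then show ?thesis by (simp add: xpow_diff_one_def)
qed

lemma coprime_xpow_diff_one_factors:
  assumes "n > 0" "xpow_diff_one n = a * b" shows "coprime a b"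
proof (rule coprimeI)
  fix c assume "c dvd a" "c dvd b"
  then have "c * c dvd xpow_diff_one n" unfolding assms(2) by (rule mult_dvd_mono)
  then show "is_unit c" by (rule xpow_diff_one_squarefree[OF assms(1)])
qed

lemma prod_dvd_of_coprime:
  fixes f :: "'b \<Rightarrow> 'a::semiring_gcd"
  assumes "finite A" "\<And>a. a \<in> A \<Longrightarrow> f a dvd x"
    "\<And>a b. a \<in> A \<Longrightarrow> b \<in> A \<Longrightarrow> a \<noteq> b \<Longrightarrow> coprime (f a) (f b)"
  shows "prod f A dvd x"
  using assms
proof (induction A rule: finite_induct)
  case (insert a A)
  then have "coprime (f a) (prod f A)" by (intro prod_coprime_right) auto
  then show ?case using insert by (simp add: divides_mult)
qed simp

text \<open>In this and the next two lemmas the product formula is a hypothesis, because they serve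
  inside the induction that proves it.\<close>

lemma cyclo_dvd_xpow_diff_one_if:
  assumes "n > 0" "(\<Prod>d | d dvd n. cyclo d) = xpow_diff_one n"
  shows "cyclo n dvd xpow_diff_one n"
  using assms(1) unfolding assms(2)[symmetric] by (intro dvd_prodI) auto

text \<open>A common factor \<open>c\<close> divides \<open>X^g - 1\<close> for the proper divisor
  \<open>g = gcd m d\<close> of \<open>d\<close>. As \<open>cyclo d * (X^g - 1)\<close> divides
  \<open>X^d - 1\<close>, the square of \<open>c\<close> divides a squarefree polynomial.\<close>

lemma coprime_xpow_diff_one_cyclo_if:
  assumes prod: "\<And>k. 0 < k \<Longrightarrow> k \<le> d \<Longrightarrow> (\<Prod>e | e dvd k. cyclo e) = xpow_diff_one k"
    and d: "d > 0" "\<not> d dvd m"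
  shows "coprime (xpow_diff_one m) (cyclo d)"
proof (rule coprimeI)
  fix c assume c: "c dvd xpow_diff_one m" "c dvd cyclo d"
  define g where "g = gcd m d"
  have "g dvd d" "g \<noteq> d" using d by (auto simp: g_def gcd_nat.absorb_iff2[symmetric])
  then have g: "g dvd d" "0 < g" "g < d" using d(1) by (auto intro: Nat.gr0I dest: dvd_imp_le)
  have "(\<Prod>e\<in>insert d {e. e dvd g}. cyclo e) dvd (\<Prod>e | e dvd d. cyclo e)"
    using g by (intro prod_dvd_prod_subset) (auto elim: dvd_trans)
  moreover have "(\<Prod>e\<in>insert d {e. e dvd g}. cyclo e) = cyclo d * (\<Prod>e | e dvd g. cyclo e)"
    using g by (intro prod.insert) (auto dest: dvd_imp_le)
  ultimately have "cyclo d * xpow_diff_one g dvd xpow_diff_one d"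
    using prod[of d] prod[of g] g by simp
  moreover have "c dvd xpow_diff_one g"
    unfolding g_def by (intro dvd_xpow_diff_one_gcd c dvd_trans[OF c(2)] cyclo_dvd_xpow_diff_one_if prod d) simp
  then have "c * c dvd cyclo d * xpow_diff_one g" by (intro mult_dvd_mono c)
  ultimately have "c * c dvd xpow_diff_one d" by (rule dvd_trans[rotated])
  then show "is_unit c" by (rule xpow_diff_one_squarefree[OF d(1)])
qed

lemma coprime_cyclo_if:
  assumes prod: "\<And>k. 0 < k \<Longrightarrow> k \<le> e \<Longrightarrow> (\<Prod>i | i dvd k. cyclo i) = xpow_diff_one k"
    and "0 < d" "d < e"
  shows "coprime (cyclo d) (cyclo e)"
proof -
  have "coprime (xpow_diff_one d) (cyclo e)"
    using assms by (intro coprime_xpow_diff_one_cyclo_if prod) (auto dest: dvd_imp_le)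
  moreover have "cyclo d dvd xpow_diff_one d"
    using assms by (intro cyclo_dvd_xpow_diff_one_if) auto
  ultimately show ?thesis by (meson coprime_divisors dvd_refl)
qed

text \<open>Since \<open>cyclo n\<close> is defined by \<open>div\<close>, the point is that the
  division is exact: for proper divisors \<open>d\<close> of \<open>n\<close>, the
  \<open>cyclo d\<close> are pairwise coprime divisors of \<open>X^n - 1\<close>.\<close>

lemma prod_cyclo: "n > 0 \<Longrightarrow> (\<Prod>d | d dvd n. cyclo d) = xpow_diff_one n"
proof (induction n rule: less_induct)
  case (less n)
  define A where "A = {d. d dvd n \<and> d < n}"
  have fin: "finite A" by (simp add: A_def)
  have A_pos: "d > 0" if "d \<in> A" for d using that less.prems by (auto simp: A_def intro: Nat.gr0I)
  have coprime: "coprime (cyclo d) (cyclo e)" if "d \<in> A" "e \<in> A" "d < e" for d e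
    using that A_pos by (intro coprime_cyclo_if less.IH) (auto simp: A_def)
  have "prod cyclo A dvd xpow_diff_one n"
  proof (rule prod_dvd_of_coprime[OF fin])
    fix d assume d: "d \<in> A"
    then have "cyclo d dvd xpow_diff_one d" using A_pos[OF d] by (intro cyclo_dvd_xpow_diff_one_if less.IH) (auto simp: A_def)
    also have "xpow_diff_one d dvd xpow_diff_one n" using d by (intro xpow_diff_one_dvd) (simp add: A_def)
    finally show "cyclo d dvd xpow_diff_one n" .
  next
    fix d e assume "d \<in> A" "e \<in> A" "d \<noteq> e"
    then show "coprime (cyclo d) (cyclo e)"
      using coprime[of d e] coprime[of e d] by (cases "d < e") (auto simp: coprime_commute)
  qed
  then have "cyclo n * prod cyclo A = xpow_diff_one n"
    by (subst cyclo.simps) (simp add: A_def xpow_diff_one_def)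
  moreover have "{d. d dvd n} = insert n A" using less.prems by (auto simp: A_def dest: dvd_imp_le)
  moreover have "n \<notin> A" by (simp add: A_def)
  ultimately show ?case using fin by simp
qed

lemma cyclo_dvd_xpow_diff_one: "n > 0 \<Longrightarrow> cyclo n dvd xpow_diff_one n"
  by (intro cyclo_dvd_xpow_diff_one_if prod_cyclo)

lemma coprime_xpow_diff_one_cyclo: "d > 0 \<Longrightarrow> \<not> d dvd m \<Longrightarrow> coprime (xpow_diff_one m) (cyclo d)"
  by (intro coprime_xpow_diff_one_cyclo_if prod_cyclo)

lemma coprime_cyclo:
  assumes "d > 0" "e > 0" "d \<noteq> e" shows "coprime (cyclo d) (cyclo e)"
  using assms coprime_cyclo_if[of e d] coprime_cyclo_if[of d e] prod_cyclo
  by (cases "d < e") (auto simp: coprime_commute)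

lemma qint_poly_eq_prod:
  assumes "n > 0" shows "qint_poly n = (\<Prod>d\<in>{d. d dvd n} - {1}. cyclo d)"
proof -
  have "xpow_diff_one 1 * qint_poly k = xpow_diff_one k" for k
    by (induction k) (auto simp: qint_poly_def xpow_diff_one_def algebra_simps mult_monom)
  moreover have "cyclo 1 = xpow_diff_one 1" using prod_cyclo[of 1] by simp
  moreover have "xpow_diff_one n = cyclo 1 * (\<Prod>d\<in>{d. d dvd n} - {1}. cyclo d)"
    unfolding prod_cyclo[OF assms, symmetric] using assms by (intro prod.remove) auto
  ultimately show ?thesis using xpow_diff_one_nonzero[of 1] by (metis mult_left_cancel zero_less_one)
qed

section \<open>Localization at a cyclotomic polynomial\<close>

definition localization :: "rat poly \<Rightarrow> ratfun set" where
  "localization P = {to_fract M / to_fract D | M D. D \<noteq> 0 \<and> coprime D P}"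

lemma localizationI: "D \<noteq> 0 \<Longrightarrow> coprime D P \<Longrightarrow> to_fract M / to_fract D \<in> localization P"
  by (auto simp: localization_def)

lemma to_fract_localization: "to_fract M \<in> localization P"
  using localizationI[of 1 P M] by simp

lemma inverse_to_fract_localization:
  "D \<noteq> 0 \<Longrightarrow> coprime D P \<Longrightarrow> inverse (to_fract D) \<in> localization P"
  using localizationI[of D P 1] by (simp add: divide_inverse)

lemma localization_diff:
  assumes "x \<in> localization P" "y \<in> localization P" shows "x - y \<in> localization P"
proof -
  obtain M D M' D' where *: "x = to_fract M / to_fract D" "D \<noteq> 0" "coprime D P"
    "y = to_fract M' / to_fract D'" "D' \<noteq> 0" "coprime D' P"
    using assms by (auto simp: localization_def)
  then have "x - y = to_fract (M * D' - M' * D) / to_fract (D * D')"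
    by (simp add: diff_frac_eq)
  then show ?thesis using * localizationI[of "D * D'" P "M * D' - M' * D"] by simp
qed

lemma localization_mult:
  assumes "x \<in> localization P" "y \<in> localization P" shows "x * y \<in> localization P"
proof -
  obtain M D M' D' where *: "x = to_fract M / to_fract D" "D \<noteq> 0" "coprime D P"
    "y = to_fract M' / to_fract D'" "D' \<noteq> 0" "coprime D' P"
    using assms by (auto simp: localization_def)
  then have "x * y = to_fract (M * M') / to_fract (D * D')"
    by simp
  then show ?thesis using * localizationI[of "D * D'" P "M * M'"] by simp
qed

lemma qvar_eq: "qvar = to_fract (monom 1 1)"
  by (simp add: qvar_def to_fract_def monom_altdef)

lemma qvar_power: "qvar ^ m = to_fract (monom 1 m)"
  by (induction m) (simp_all add: qvar_eq to_fract_mult[symmetric] mult_monom del: to_fract_mult)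

lemma one_minus_qvar_power: "1 - qvar ^ m = - to_fract (xpow_diff_one m)"
  by (simp add: qvar_power xpow_diff_one_def)

lemma coprime_monom_cyclo:
  assumes "d > 0" shows "coprime (monom 1 1) (cyclo d)"
proof (rule coprimeI)
  fix c :: "rat poly" assume c: "c dvd monom 1 1" "c dvd cyclo d"
  have "monom 1 1 * monom 1 (d - 1) = (monom 1 d :: rat poly)"
    using assms by (simp add: mult_monom)
  then have "c dvd monom 1 d" using c(1) by (metis dvd_mult2)
  moreover have "c dvd xpow_diff_one d" using c(2) cyclo_dvd_xpow_diff_one[OF assms] by (rule dvd_trans)
  ultimately have "c dvd monom 1 d - xpow_diff_one d" by (rule dvd_diff)
  then show "is_unit c" by (simp add: xpow_diff_one_def)
qed

lemma q_local_ring_localization_cyclo: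
  assumes "d > 1" "d dvd 4 * N + 1"
  shows "q_local_ring (localization (cyclo d)) (to_fract (cyclo d)) qvar d N"
proof
  have d: "d > 0" using assms by simp
  show "1 < d" "d dvd 4 * N + 1" by (fact assms)+
  fix x y assume "x \<in> localization (cyclo d)" "y \<in> localization (cyclo d)"
  then show "x - y \<in> localization (cyclo d)" "x * y \<in> localization (cyclo d)"
    by (rule localization_diff, rule localization_mult)
next
  have d: "d > 0" using assms by simp
  show "1 \<in> localization (cyclo d)"
    using to_fract_localization[of 1] by simp
  show "to_fract (cyclo d) \<in> localization (cyclo d)" "qvar \<in> localization (cyclo d)"
    by (simp_all add: to_fract_localization qvar_eq)
  have "coprime 2 (cyclo d)"
    by (rule is_unit_left_imp_coprime) (simp add: is_unit_iff_degree)
  then show "inverse 2 \<in> localization (cyclo d)"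
    using inverse_to_fract_localization[of 2 "cyclo d"] to_fract_add[of "1::rat poly" 1] by simp
  have "to_fract (2::rat poly) = 2"
    using to_fract_add[of "1::rat poly" 1] by simp
  then show "(2::ratfun) \<noteq> 0"
    using to_fract_eq_0_iff[of "2::rat poly"] by simp
  show "inverse qvar \<in> localization (cyclo d)"
    unfolding qvar_eq by (intro inverse_to_fract_localization coprime_monom_cyclo d) (simp add: monom_eq_0_iff)
  show "qvar \<noteq> 0"
    by (simp add: qvar_eq monom_eq_0_iff)
  show "qvar ^ m \<noteq> 1" if "m > 0" for m
    using one_minus_qvar_power[of m] xpow_diff_one_nonzero[OF that] by auto
  show "\<exists>z\<in>localization (cyclo d). 1 - qvar ^ d = to_fract (cyclo d) * z"
  proof -
    obtain s where "xpow_diff_one d = cyclo d * s" using cyclo_dvd_xpow_diff_one[OF d] by blast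
    then have "1 - qvar ^ d = to_fract (cyclo d) * to_fract (- s)"
      unfolding one_minus_qvar_power by simp
    then show ?thesis using to_fract_localization by blast
  qed
  show "inverse (1 - qvar ^ m) \<in> localization (cyclo d)" if "\<not> d dvd m" for m
  proof -
    have "m > 0" using that by (auto intro: Nat.gr0I)
    then have "inverse (to_fract (- xpow_diff_one m)) \<in> localization (cyclo d)"
      using coprime_xpow_diff_one_cyclo[OF d that] xpow_diff_one_nonzero by (intro inverse_to_fract_localization) auto
    then show ?thesis by (simp add: one_minus_qvar_power)
  qed
  show "(1 - qvar ^ d) / (1 - qvar ^ (d * m)) \<in> localization (cyclo d)" if "m > 0" for m
  proof -
    obtain Q where Q: "xpow_diff_one (d * m) = xpow_diff_one d * Q" using xpow_diff_one_dvd[of d "d * m"] by auto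
    have "Q \<noteq> 0" using Q xpow_diff_one_nonzero[of "d * m"] that d by auto
    \<comment> \<open>\<open>X^(dm) - 1\<close> is squarefree, so the cofactor \<open>Q\<close>
      shares no factor with \<open>X^d - 1\<close>, hence none with \<open>cyclo d\<close>.\<close>
    moreover have "coprime (xpow_diff_one d) Q"
      using that d by (intro coprime_xpow_diff_one_factors[OF _ Q]) simp
    then have "coprime (cyclo d) Q"
      by (rule coprime_divisors[OF cyclo_dvd_xpow_diff_one[OF d] dvd_refl])
    then have "coprime Q (cyclo d)"
      by (simp only: coprime_commute)
    moreover have "(1 - qvar ^ d) / (1 - qvar ^ (d * m)) = inverse (to_fract Q)"
      unfolding one_minus_qvar_power Q using xpow_diff_one_nonzero[OF d] by (simp add: field_simps)
    ultimately show ?thesis by (simp add: inverse_to_fract_localization)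
  qed
qed

section \<open>From local divisibility to a congruence of rational functions\<close>

lemma reduced_fraction_dvd:
  assumes x: "x = to_fract M / to_fract D" "D \<noteq> 0" "coprime M D"
    and z: "z \<in> localization P" "x = to_fract P ^ e * z"
  shows "coprime D P" "P ^ e dvd M"
proof -
  obtain M' D' where z': "z = to_fract M' / to_fract D'" "D' \<noteq> 0" "coprime D' P"
    using z(1) by (auto simp: localization_def)
  have "to_fract (P ^ e) = to_fract P ^ e"
    by (induction e) simp_all
  then have "to_fract (M * D') = to_fract (P ^ e * M' * D)"
    using x(1,2) z(2) z'(1,2) by (simp add: field_simps)
  then have eq: "M * D' = P ^ e * M' * D" by (simp only: to_fract_eq_iff)
  \<comment> \<open>Lowest terms force \<open>D\<close> into \<open>D'\<close>, which is coprime to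
    \<open>P\<close>; that coprimality also moves \<open>P ^ e\<close> into \<open>M\<close>
    below.\<close>
  then have "D dvd D'"
    using x(3) by (metis coprime_commute coprime_dvd_mult_right_iff dvd_triv_right)
  then show "coprime D P"
    using z'(3) by (meson coprime_divisors dvd_refl)
  have "P ^ e dvd M * D'" unfolding eq by simp
  moreover have "coprime (P ^ e) D'" using z'(3) by (simp add: coprime_commute)
  ultimately show "P ^ e dvd M" by (simp add: coprime_dvd_mult_left_iff)
qed

text \<open>Each \<open>d\<close> comes with its own fraction, whereas \<open>qcong\<close> needs a
  single one; the fraction in lowest terms serves every \<open>d\<close>. The modulus is
  \<open>cyclo n ^ 3\<close> times the \<open>cyclo d\<close> for the divisors
  \<open>1 < d < n\<close>, all pairwise coprime.\<close>

lemma qcongI: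
  assumes n: "n > 1"
    and local: "\<And>d. d dvd n \<Longrightarrow> d > 1 \<Longrightarrow> \<exists>z\<in>localization (cyclo d). A - B = to_fract (cyclo d) * z"
    and cube: "\<exists>z\<in>localization (cyclo n). A - B = to_fract (cyclo n) ^ 3 * z"
  shows "qcong A B (qint_poly n * cyclo n ^ 2)"
proof -
  define M D where "M = fst (quot_of_fract (A - B))" and "D = snd (quot_of_fract (A - B))"
  have MD: "A - B = to_fract M / to_fract D" "D \<noteq> 0" "coprime M D"
    by (simp_all add: M_def D_def coprime_quot_of_fract flip: Fract_conv_to_fract)
  define S where "S = {d. d dvd n} - {1, n}"
  have fin: "finite S" using n by (simp add: S_def)
  have S: "d dvd n" "d > 1" "d \<noteq> n" if "d \<in> S" for d
    using that n by (auto simp: S_def intro!: Suc_lessI Nat.gr0I)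
  have 1: "coprime D (cyclo d)" "cyclo d dvd M" if "d dvd n" "d > 1" for d
    using local[OF that] reduced_fraction_dvd[OF MD, of _ "cyclo d" 1] by auto
  have 3: "coprime D (cyclo n)" "cyclo n ^ 3 dvd M"
    using cube reduced_fraction_dvd[OF MD, of _ "cyclo n" 3] by auto
  have "{d. d dvd n} - {1} = insert n S" "n \<notin> S" using n by (auto simp: S_def)
  then have "qint_poly n = cyclo n * prod cyclo S"
    using qint_poly_eq_prod[of n] n fin by simp
  then have P: "qint_poly n * cyclo n ^ 2 = cyclo n ^ 3 * prod cyclo S"
    by (simp add: power2_eq_square power3_eq_cube mult_ac)
  have "prod cyclo S dvd M"
    using 1(2) S by (intro prod_dvd_of_coprime fin coprime_cyclo) (auto intro: less_trans[OF zero_less_one])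
  moreover have "coprime (cyclo n ^ 3) (prod cyclo S)"
    unfolding coprime_power_left_iff
    using S n by (intro disjI1 prod_coprime_right coprime_cyclo) (auto intro: less_trans[OF zero_less_one])
  ultimately have "qint_poly n * cyclo n ^ 2 dvd M"
    unfolding P using 3 by (intro divides_mult)
  moreover have "coprime D (qint_poly n * cyclo n ^ 2)"
    unfolding P using 1(1) 3(1) S by (simp add: prod_coprime_right)
  moreover have "A - B = Fract M D" using MD(1) by (simp add: Fract_conv_to_fract)
  ultimately show ?thesis
    unfolding qcong_def using MD(2) by blast
qed

lemma qcong_refl: "qcong A A P"
  unfolding qcong_def by (intro exI[of _ 0] exI[of _ 1]) (simp add: fract_collapse)

theorem theorem1:
  fixes n :: nat
  assumes "n > 0" and "n mod 4 = 1"
  shows "qcong (\<Sum>k=0..(n - 1) div 4. qint qvar (8*k+1) * qpoch qvar (qvar^4) k ^ 4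
              / qpoch (qvar^4) (qvar^4) k ^ 4 * qvar ^ (2*k))
            (qpoch (qvar^2) (qvar^4) ((n - 1) div 4) / qpoch (qvar^4) (qvar^4) ((n - 1) div 4)
              * qint qvar n * qvar powi ((1 - int n) div 4))
            (qint_poly n * cyclo n ^ 2)
       \<and> qcong (\<Sum>k=0..n - 1. qint qvar (8*k+1) * qpoch qvar (qvar^4) k ^ 4
              / qpoch (qvar^4) (qvar^4) k ^ 4 * qvar ^ (2*k))
            (qpoch (qvar^2) (qvar^4) ((n - 1) div 4) / qpoch (qvar^4) (qvar^4) ((n - 1) div 4)
              * qint qvar n * qvar powi ((1 - int n) div 4))
            (qint_poly n * cyclo n ^ 2)"
proof -
  define N where "N = (n - 1) div 4"
  have n: "n = 4 * N + 1" using assms unfolding N_def by presburger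
  have "(1 - int n) div 4 = - int N" by (simp add: n)
  then have powi: "qvar powi ((1 - int n) div 4) = inverse (qvar ^ N)"
    by (simp add: power_int_minus)
  have sets: "{0..N} = {..N}" "{0..n - 1} = {..<n}"
    using assms(1) by auto
  define t where "t k = qint qvar (8 * k + 1) * qpoch qvar (qvar ^ 4) k ^ 4
      / qpoch (qvar ^ 4) (qvar ^ 4) k ^ 4 * qvar ^ (2 * k)" for k
  define b where "b = qpoch (qvar ^ 2) (qvar ^ 4) N / qpoch (qvar ^ 4) (qvar ^ 4) N
      * qint qvar (4 * N + 1) * inverse (qvar ^ N)"
  have "qcong (\<Sum>k\<le>N. t k) b (qint_poly n * cyclo n ^ 2) \<and>
        qcong (\<Sum>k<4 * N + 1. t k) b (qint_poly n * cyclo n ^ 2)"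
  \<comment> \<open>For \<open>n = 1\<close> there is no divisor \<open>d > 1\<close> to localize
    at; both sides are then exactly 1.\<close>
  proof (cases "N = 0")
    case True
    have "1 - qvar \<noteq> 0" using one_minus_qvar_power[of 1] xpow_diff_one_nonzero[of 1] by auto
    then have "t 0 = b"
      by (simp add: t_def b_def True qint_def)
    then show ?thesis by (simp add: True qcong_refl)
  next
    case False
    then have n1: "n > 1" by (simp add: n)
    have loc: "q_local_ring (localization (cyclo d)) (to_fract (cyclo d)) qvar d N"
      if "d dvd n" "d > 1" for d
      using that n by (intro q_local_ring_localization_cyclo) auto
    \<comment> \<open>\<open>summand\<close> depends only on \<open>q\<close>, and
      \<open>closed_form\<close> only on \<open>q\<close> and \<open>N\<close>, so the instance
      \<open>d = n\<close> identifies \<open>t\<close> and \<open>b\<close> for all divisors at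
      once.\<close>
    have "t = q_local_ring.summand qvar" "b = q_local_ring.closed_form qvar N"
      using q_local_ring.summand_eq[OF loc[OF _ n1]] q_local_ring.closed_form_eq[OF loc[OF _ n1]]
      by (simp_all add: t_def b_def fun_eq_iff)
    note tb = this
    show ?thesis
      unfolding tb
      by (intro conjI qcongI[OF n1] q_local_ring.sums_cg[OF loc] q_local_ring.sum_summand_cg_cube[OF loc[OF dvd_refl n1] n])
  qed
  then show ?thesis
    unfolding t_def b_def n[symmetric] N_def[symmetric] sets powi .
qed

end
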